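(* Consider $dX(t)=A(t,X(t))\,dt+B(t)\,dW(t)$. Suppose that the conditions Hemicontinuity, Strong monotonicity (with constants $r>2$, $\lambda>0$), Coercivity and Boundedness (stated in the context) hold. Then the unique $L^2$-bounded solution $X(t)$, $t\in\mathbb R$, is globally asymptotically stable in square-mean sense. Moreover, for any $t\ge s$ and $\zeta_s\in L^2(\Omega,\mathcal F_s,P;H)$, $$E\|X(t,s,\zeta_s)-X(t)\|_H^2\le E\|\zeta_s-X(s)\|_H^2\wedge\left\{\frac{\lambda}{2}(r-2)(t-s)\right\}^{-\frac{2}{r-2}} .$$
   Context: Setting. $(H,\langle\cdot,\cdot\rangle_H)$ is a separable Hilbert space identified with its dual, $(V,\|\cdot\|_V)$ a reflexive Banach space embedded continuously and densely in $H$, so $V\subset H\subset V^*$ with pairing ${}_{V^*}\langle\cdot,\cdot\rangle_V$ extending $\langle\cdot,\cdot\rangle_H$. $W(t)$, $t\in\mathbb R$, is a two-sided cylindrical Wiener process ($Q=I$) on a separable Hilbert space $U$ with respect to a complete filtered probability space $(\Omega,\mathcal F,(\mathcal F_t)_{t\in\mathbb R},P)$; $L_2(U,H)$ is the space of Hilbert–Schmidt operators. $A:\mathbb R\times V\to V^*$ and $B:\mathbb R\to L_2(U,H)$ are measurable. $a\wedge b=\min(a,b)$, and the second term of the minimum is read as $+\infty$ when $t=s$. Conditions: Hemicontinuity: for all $u,v,w\in V$, $t\in\mathbb R$ the map $\mathbb R\ni\theta\mapsto{}_{V^*}\langle A(t,u+\theta v),w\rangle_V$ is continuous. Strong monotonicity: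 there are $r>2$ and $\lambda>0$ with $2\,{}_{V^*}\langle A(t,u)-A(t,v),u-v\rangle_V\le-\lambda\|u-v\|_H^r$ for all $u,v\in V$, $t\in\mathbb R$. Coercivity: there are $\alpha\in(1,\infty)$, $c_1\in\mathbb R$, $c_2,M_0\in(0,\infty)$ with $2\,{}_{V^*}\langle A(t,v),v\rangle_V+\|B(t)\|_{L_2(U,H)}^2\le c_1\|v\|_H^2-c_2\|v\|_V^\alpha+M_0$ for all $v\in V$, $t\in\mathbb R$. Boundedness: there is $c_3\in(0,\infty)$ with $\|A(t,v)\|_{V^*}\le c_3\|v\|_V^{\alpha-1}+M_0$ for all $v\in V$, $t\in\mathbb R$ (same $\alpha$, $M_0$). Solution: a continuous $H$-valued $(\mathcal F_t)$-adapted process $X$ on an interval $I\subset\mathbb R$ is a solution if for every compact $J\subset I$ its $dt\otimes P$-equivalence class $\widehat X$ lies in $L^\alpha(J\times\Omega;V)\cap L^2(J\times\Omega;H)$ and $P$-a.s. $X(t)=X(q)+\int_q^tA(\sigma,\overline X(\sigma))d\sigma+\int_q^tB(\sigma)dW(\sigma)$ for all $q\le t$ in $I$, where $\overline X$ is any $V$-valued progressively measurable $dt\otimes P$-version of $\widehat X$. For $\zeta_s\in L^2(\Omega,\mathcal F_s,P;H)$, $X(t,s,\zeta_s)$, $t\ge s$, is the (unique) solution with $X(s)=\zeta_s$. A process is $L^2$-bounded if $\sup_{t\in\mathbb R}E\|X(t)\|_H^2<\infty$; under the conditions Hemicontinuity, Strong monotonicity, Coercivity and Boundedness there is exactly one $L^2$-bounded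 continuous solution on $\mathbb R$. Stability: a solution $X(\cdot)$ is globally asymptotically stable in square-mean sense if $\lim_{t\to\infty}E\|X(t,0,\zeta_0)-X(t)\|_H^2=0$ for any $\zeta_0\in L^2(\Omega,\mathcal F_0,P;H)$. *)

theory Defs
  imports "HOL-Probability.Probability"
begin

section \<open>Gelfand triples\<close>

text \<open>The spaces \<open>U\<close> and \<open>H\<close> are types of sort
  \<open>{real_inner, banach, second_countable_topology}\<close>, i.e. real separable Hilbert spaces.
  \<open>V\<close> is a type of sort \<open>banach\<close>, its dual is \<open>'v \<Rightarrow>\<^sub>L real\<close>, and
  \<open>i\<close> is the embedding of \<open>V\<close> into \<open>H\<close>.\<close>

definition reflexive_space :: "'v::banach itself \<Rightarrow> bool" where
  "reflexive_space _ \<longleftrightarrow>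
     (\<forall>\<phi> :: ('v \<Rightarrow>\<^sub>L real) \<Rightarrow>\<^sub>L real. \<exists>v. \<forall>f. blinfun_apply \<phi> f = blinfun_apply f v)"

definition gelfand_triple :: "('v::banach \<Rightarrow> 'h::{real_inner, banach, second_countable_topology}) \<Rightarrow> bool" where
  "gelfand_triple i \<longleftrightarrow>
     reflexive_space TYPE('v) \<and> bounded_linear i \<and> inj i \<and> closure (range i) = UNIV"

text \<open>The embedding of \<open>H\<close> into \<open>V\<^sup>*\<close> given by the Riesz identification of \<open>H\<close> with its dual:
  \<open>x\<close> is sent to the functional \<open>v \<mapsto> \<langle>x, i v\<rangle>\<close>. Thus the duality pairing extends the
  inner product of \<open>H\<close> by construction.\<close>

definition to_dual :: "('v::banach \<Rightarrow> 'h::real_inner) \<Rightarrow> 'h \<Rightarrow> ('v \<Rightarrow>\<^sub>L real)" where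
  "to_dual i x = Blinfun (\<lambda>v. x \<bullet> i v)"

text \<open>Same definition as the library's \<open>has_bochner_integral\<close>, which however is restricted to types
  of class \<open>second_countable_topology\<close>; there is no such instance for \<open>'v \<Rightarrow>\<^sub>L real\<close>,
  although \<open>V\<^sup>*\<close> is separable in every Gelfand triple.\<close>

definition has_bochner_integral_gen :: "'a measure \<Rightarrow> ('a \<Rightarrow> 'b::real_normed_vector) \<Rightarrow> 'b \<Rightarrow> bool" where
  "has_bochner_integral_gen M f x \<longleftrightarrow>
     f \<in> borel_measurable M \<and>
     (\<exists>g :: nat \<Rightarrow> 'a \<Rightarrow> 'b.
        (\<forall>n. Bochner_Integration.simple_bochner_integrable M (g n)) \<and>
        (\<lambda>n. \<integral>\<^sup>+ y. ennreal (norm (f y - g n y)) \<partial>M) \<longlonglongrightarrow> 0 \<and>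
        (\<lambda>n. Bochner_Integration.simple_bochner_integral M (g n)) \<longlonglongrightarrow> x)"


section \<open>Hilbert--Schmidt operators\<close>

definition orthonormal_basis :: "'u::real_inner set \<Rightarrow> bool" where
  "orthonormal_basis E \<longleftrightarrow>
     pairwise orthogonal E \<and> (\<forall>e\<in>E. norm e = 1) \<and> closure (span E) = UNIV"

text \<open>One fixed orthonormal basis; the notions below do not depend on the choice.\<close>

definition some_onb :: "'u::{real_inner, banach, second_countable_topology} set" where
  "some_onb = (SOME E. orthonormal_basis E)"

definition hilbert_schmidt ::
  "('u::{real_inner, banach, second_countable_topology} \<Rightarrow>\<^sub>L 'h::{real_inner, banach, second_countable_topology}) \<Rightarrow> bool" where
  "hilbert_schmidt T \<longleftrightarrow> (\<lambda>e. (norm (blinfun_apply T e))\<^sup>2) summable_on some_onb"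

definition hs_norm ::
  "('u::{real_inner, banach, second_countable_topology} \<Rightarrow>\<^sub>L 'h::{real_inner, banach, second_countable_topology}) \<Rightarrow> real" where
  "hs_norm T = sqrt (\<Sum>\<^sub>\<infinity>e\<in>some_onb. (norm (blinfun_apply T e))\<^sup>2)"

text \<open>The Borel \<open>\<sigma>\<close>-algebra of the normed space \<open>L\<^sub>2(U,H)\<close>, generated by the sets that are open
  for \<open>hs_norm\<close>.\<close>

definition hs_borel ::
  "('u::{real_inner, banach, second_countable_topology} \<Rightarrow>\<^sub>L 'h::{real_inner, banach, second_countable_topology}) measure" where
  "hs_borel = sigma {T. hilbert_schmidt T}
     {G. G \<subseteq> {T. hilbert_schmidt T} \<and>
         (\<forall>T\<in>G. \<exists>\<epsilon>>0. \<forall>S. hilbert_schmidt S \<and> hs_norm (S - T) < \<epsilon> \<longrightarrow> S \<in> G)}"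


section \<open>Cylindrical Wiener processes and the stochastic integral\<close>

text \<open>Completeness means that \<open>P\<close> is complete and that all null sets belong to every \<open>F t\<close>;
  right-continuity of the filtration is not required.\<close>

definition complete_filtered_prob_space :: "'o measure \<Rightarrow> (real \<Rightarrow> 'o measure) \<Rightarrow> bool" where
  "complete_filtered_prob_space P F \<longleftrightarrow>
     prob_space P \<and> complete_measure P \<and> filtration (space P) F \<and>
     (\<forall>t. sets (F t) \<subseteq> sets P \<and> null_sets P \<subseteq> sets (F t))"

text \<open>A cylindrical process is represented by its coordinates: \<open>W t u\<close> is the real random variable
  usually written \<open>\<langle>W(t), u\<rangle>\<close>; the \<open>U\<close>-valued variable \<open>W(t)\<close> itself does not exist if
  \<open>dim U = \<infinity>\<close>. As \<open>W(0) = 0\<close>, a two-sided process cannot be adapted at negative times;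
  only its increments are.\<close>

definition cylindrical_wiener ::
  "'o measure \<Rightarrow> (real \<Rightarrow> 'o measure) \<Rightarrow>
   (real \<Rightarrow> 'u::{real_inner, banach, second_countable_topology} \<Rightarrow> 'o \<Rightarrow> real) \<Rightarrow> bool" where
  "cylindrical_wiener P F W \<longleftrightarrow>
     (\<forall>u. AE \<omega> in P. W 0 u \<omega> = 0) \<and>
     (\<forall>t a b u v. AE \<omega> in P. W t (a *\<^sub>R u + b *\<^sub>R v) \<omega> = a * W t u \<omega> + b * W t v \<omega>) \<and>
     (\<forall>u. AE \<omega> in P. continuous_on UNIV (\<lambda>t. W t u \<omega>)) \<and>
     (\<forall>s t u. s \<le> t \<longrightarrow> (\<lambda>\<omega>. W t u \<omega> - W s u \<omega>) \<in> borel_measurable (F t)) \<and>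
     (\<forall>s t. s \<le> t \<longrightarrow>
        prob_space.indep_set P (sets (F s))
          (sigma_sets (space P)
             {(\<lambda>\<omega>. W t u \<omega> - W s u \<omega>) -` S \<inter> space P | u S. S \<in> sets borel})) \<and>
     (\<forall>s t u. s < t \<and> u \<noteq> 0 \<longrightarrow>
        distributed P lborel (\<lambda>\<omega>. W t u \<omega> - W s u \<omega>) (normal_density 0 (sqrt (t - s) * norm u)))"

definition rank_one :: "'h::real_normed_vector \<Rightarrow> 'u::real_inner \<Rightarrow> ('u \<Rightarrow>\<^sub>L 'h)" where
  "rank_one h u = blinfun_scaleR_left h o\<^sub>L blinfun_inner_right u"

text \<open>A list of tuples \<open>(a, b, \<xi>, u, h)\<close> represents the elementary integrand
  \<open>\<Sum> 1\<^bsub>(a,b]\<^esub>(\<sigma>) \<xi>(\<omega>) \<langle>u, \<cdot>\<rangle> h\<close> with values in the finite-rank operators, which are dense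
  in \<open>L\<^sub>2(U,H)\<close>.\<close>

type_synonym ('o, 'u, 'h) elementary = "(real \<times> real \<times> ('o \<Rightarrow> real) \<times> 'u \<times> 'h) list"

definition elementary_integrand ::
  "'o measure \<Rightarrow> (real \<Rightarrow> 'o measure) \<Rightarrow> real \<Rightarrow> real \<Rightarrow> ('o, 'u, 'h) elementary \<Rightarrow> bool" where
  "elementary_integrand P F q t \<Psi> \<longleftrightarrow>
     (\<forall>(a, b, \<xi>, u, h) \<in> set \<Psi>. q \<le> a \<and> a \<le> b \<and> b \<le> t \<and>
        \<xi> \<in> borel_measurable (F a) \<and> (\<exists>C. \<forall>\<omega>\<in>space P. \<bar>\<xi> \<omega>\<bar> \<le> C))"

definition elementary_value ::
  "('o, 'u::real_inner, 'h::real_normed_vector) elementary \<Rightarrow> real \<Rightarrow> 'o \<Rightarrow> ('u \<Rightarrow>\<^sub>L 'h)" where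
  "elementary_value \<Psi> \<sigma> \<omega> =
     (\<Sum>(a, b, \<xi>, u, h) \<leftarrow> \<Psi>. (indicator {a<..b} \<sigma> * \<xi> \<omega>) *\<^sub>R rank_one h u)"

definition elementary_integral ::
  "(real \<Rightarrow> 'u \<Rightarrow> 'o \<Rightarrow> real) \<Rightarrow> ('o, 'u::real_inner, 'h::real_normed_vector) elementary \<Rightarrow> 'o \<Rightarrow> 'h" where
  "elementary_integral W \<Psi> \<omega> =
     (\<Sum>(a, b, \<xi>, u, h) \<leftarrow> \<Psi>. (\<xi> \<omega> * (W b u \<omega> - W a u \<omega>)) *\<^sub>R h)"

text \<open>\<open>Z\<close> is (a version of) the Ito integral of \<open>\<Phi>\<close> over \<open>[q,t]\<close>: the \<open>L\<^sup>2\<close>-limit of the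
  integrals of elementary integrands that approximate \<open>\<Phi>\<close> in
  \<open>L\<^sup>2([q,t] \<times> \<Omega>, dt \<otimes> P; L\<^sub>2(U,H))\<close>.\<close>

definition is_ito_integral ::
  "'o measure \<Rightarrow> (real \<Rightarrow> 'o measure) \<Rightarrow>
   (real \<Rightarrow> 'u::{real_inner, banach, second_countable_topology} \<Rightarrow> 'o \<Rightarrow> real) \<Rightarrow>
   (real \<Rightarrow> 'o \<Rightarrow> ('u \<Rightarrow>\<^sub>L 'h::{real_inner, banach, second_countable_topology})) \<Rightarrow>
   real \<Rightarrow> real \<Rightarrow> ('o \<Rightarrow> 'h) \<Rightarrow> bool" where
  "is_ito_integral P F W \<Phi> q t Z \<longleftrightarrow>
     Z \<in> borel_measurable P \<and>
     (\<exists>\<Psi> :: nat \<Rightarrow> ('o, 'u, 'h) elementary.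
        (\<forall>n. elementary_integrand P F q t (\<Psi> n)) \<and>
        (\<lambda>n. \<integral>\<^sup>+ (\<sigma>, \<omega>). ennreal ((hs_norm (elementary_value (\<Psi> n) \<sigma> \<omega> - \<Phi> \<sigma> \<omega>))\<^sup>2)
              \<partial>(restrict_space lborel {q..t} \<Otimes>\<^sub>M P)) \<longlonglongrightarrow> 0 \<and>
        (\<lambda>n. \<integral>\<^sup>+ \<omega>. ennreal ((norm (elementary_integral W (\<Psi> n) \<omega> - Z \<omega>))\<^sup>2) \<partial>P) \<longlonglongrightarrow> 0)"

text \<open>A continuous process whose increments are the integrals of \<open>\<Phi>\<close>. It is determined up to
  indistinguishability and an additive random variable, so that the process
  \<open>(q,t) \<mapsto> \<integral>\<^sub>q\<^sup>t \<Phi> dW\<close> below is determined up to indistinguishability. A version that is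
  simultaneous in \<open>q\<close> and \<open>t\<close> is needed in order to state the equation almost surely for all
  \<open>q \<le> t\<close>.\<close>

definition is_ito_process ::
  "'o measure \<Rightarrow> (real \<Rightarrow> 'o measure) \<Rightarrow>
   (real \<Rightarrow> 'u::{real_inner, banach, second_countable_topology} \<Rightarrow> 'o \<Rightarrow> real) \<Rightarrow>
   (real \<Rightarrow> 'o \<Rightarrow> ('u \<Rightarrow>\<^sub>L 'h::{real_inner, banach, second_countable_topology})) \<Rightarrow>
   (real \<Rightarrow> 'o \<Rightarrow> 'h) \<Rightarrow> bool" where
  "is_ito_process P F W \<Phi> M \<longleftrightarrow>
     (\<forall>q t. q \<le> t \<longrightarrow> is_ito_integral P F W \<Phi> q t (\<lambda>\<omega>. M t \<omega> - M q \<omega>)) \<and>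
     (\<forall>\<omega>\<in>space P. continuous_on UNIV (\<lambda>t. M t \<omega>))"

definition ito_integral ::
  "'o measure \<Rightarrow> (real \<Rightarrow> 'o measure) \<Rightarrow>
   (real \<Rightarrow> 'u::{real_inner, banach, second_countable_topology} \<Rightarrow> 'o \<Rightarrow> real) \<Rightarrow>
   (real \<Rightarrow> 'o \<Rightarrow> ('u \<Rightarrow>\<^sub>L 'h::{real_inner, banach, second_countable_topology})) \<Rightarrow>
   real \<Rightarrow> real \<Rightarrow> 'o \<Rightarrow> 'h" where
  "ito_integral P F W \<Phi> q t \<omega> =
     (let M = (SOME M. is_ito_process P F W \<Phi> M) in M t \<omega> - M q \<omega>)"


section \<open>Conditions on the coefficients\<close>

definition hemicontinuity :: "(real \<Rightarrow> 'v::banach \<Rightarrow> ('v \<Rightarrow>\<^sub>L real)) \<Rightarrow> bool" where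
  "hemicontinuity A \<longleftrightarrow>
     (\<forall>u v w t. continuous_on UNIV (\<lambda>\<theta>::real. blinfun_apply (A t (u + \<theta> *\<^sub>R v)) w))"

definition strong_monotonicity ::
  "('v::banach \<Rightarrow> 'h::real_inner) \<Rightarrow> (real \<Rightarrow> 'v \<Rightarrow> ('v \<Rightarrow>\<^sub>L real)) \<Rightarrow> real \<Rightarrow> real \<Rightarrow> bool" where
  "strong_monotonicity i A r lam \<longleftrightarrow>
     (\<forall>u v t. 2 * blinfun_apply (A t u - A t v) (u - v) \<le> - lam * norm (i (u - v)) powr r)"

definition coercivity ::
  "('v::banach \<Rightarrow> 'h::{real_inner, banach, second_countable_topology}) \<Rightarrow>
   (real \<Rightarrow> 'v \<Rightarrow> ('v \<Rightarrow>\<^sub>L real)) \<Rightarrow>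
   (real \<Rightarrow> ('u::{real_inner, banach, second_countable_topology} \<Rightarrow>\<^sub>L 'h)) \<Rightarrow>
   real \<Rightarrow> real \<Rightarrow> real \<Rightarrow> real \<Rightarrow> bool" where
  "coercivity i A B \<alpha> c1 c2 M0 \<longleftrightarrow>
     (\<forall>v t. 2 * blinfun_apply (A t v) v + (hs_norm (B t))\<^sup>2
              \<le> c1 * (norm (i v))\<^sup>2 - c2 * norm v powr \<alpha> + M0)"

definition boundedness ::
  "(real \<Rightarrow> 'v::banach \<Rightarrow> ('v \<Rightarrow>\<^sub>L real)) \<Rightarrow> real \<Rightarrow> real \<Rightarrow> real \<Rightarrow> bool" where
  "boundedness A \<alpha> c3 M0 \<longleftrightarrow> (\<forall>v t. norm (A t v) \<le> c3 * norm v powr (\<alpha> - 1) + M0)"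


section \<open>Solutions\<close>

definition progressively_measurable ::
  "(real \<Rightarrow> 'o measure) \<Rightarrow> real set \<Rightarrow> (real \<Rightarrow> 'o \<Rightarrow> 'b::topological_space) \<Rightarrow> bool" where
  "progressively_measurable F I Y \<longleftrightarrow>
     (\<forall>t\<in>I. (\<lambda>(\<sigma>, \<omega>). Y \<sigma> \<omega>) \<in> borel_measurable (restrict_space borel (I \<inter> {..t}) \<Otimes>\<^sub>M F t))"

text \<open>\<open>Y\<close> is a \<open>V\<close>-valued progressively measurable \<open>dt \<otimes> P\<close>-version of \<open>X\<close> on \<open>I\<close>, of class
  \<open>L\<^sup>\<alpha>(J \<times> \<Omega>; V) \<inter> L\<^sup>2(J \<times> \<Omega>; H)\<close> for all compact \<open>J \<subseteq> I\<close>.\<close>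

definition V_version ::
  "'o measure \<Rightarrow> (real \<Rightarrow> 'o measure) \<Rightarrow> ('v::banach \<Rightarrow> 'h::{real_inner, banach, second_countable_topology}) \<Rightarrow>
   real \<Rightarrow> real set \<Rightarrow> (real \<Rightarrow> 'o \<Rightarrow> 'h) \<Rightarrow> (real \<Rightarrow> 'o \<Rightarrow> 'v) \<Rightarrow> bool" where
  "V_version P F i \<alpha> I X Y \<longleftrightarrow>
     progressively_measurable F I Y \<and>
     (AE (\<sigma>, \<omega>) in restrict_space lborel I \<Otimes>\<^sub>M P. i (Y \<sigma> \<omega>) = X \<sigma> \<omega>) \<and>
     (\<forall>J. compact J \<and> J \<subseteq> I \<longrightarrow>
        (\<integral>\<^sup>+ (\<sigma>, \<omega>). ennreal (norm (Y \<sigma> \<omega>) powr \<alpha>) \<partial>(restrict_space lborel J \<Otimes>\<^sub>M P)) < \<infinity> \<and>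
        (\<integral>\<^sup>+ (\<sigma>, \<omega>). ennreal ((norm (i (Y \<sigma> \<omega>)))\<^sup>2) \<partial>(restrict_space lborel J \<Otimes>\<^sub>M P)) < \<infinity>)"

text \<open>In the equation, which holds in \<open>V\<^sup>*\<close>, the integral of the drift is the Bochner integral in
  \<open>V\<^sup>*\<close>. Neither integral depends on the version \<open>Y\<close>.\<close>

definition solution ::
  "'o measure \<Rightarrow> (real \<Rightarrow> 'o measure) \<Rightarrow>
   (real \<Rightarrow> 'u::{real_inner, banach, second_countable_topology} \<Rightarrow> 'o \<Rightarrow> real) \<Rightarrow>
   ('v::banach \<Rightarrow> 'h::{real_inner, banach, second_countable_topology}) \<Rightarrow>
   (real \<Rightarrow> 'v \<Rightarrow> ('v \<Rightarrow>\<^sub>L real)) \<Rightarrow> (real \<Rightarrow> ('u \<Rightarrow>\<^sub>L 'h)) \<Rightarrow>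
   real \<Rightarrow> real set \<Rightarrow> (real \<Rightarrow> 'o \<Rightarrow> 'h) \<Rightarrow> bool" where
  "solution P F W i A B \<alpha> I X \<longleftrightarrow>
     (AE \<omega> in P. continuous_on I (\<lambda>t. X t \<omega>)) \<and>
     (\<forall>t\<in>I. X t \<in> borel_measurable (F t)) \<and>
     (\<exists>Y. V_version P F i \<alpha> I X Y \<and>
        (AE \<omega> in P. \<forall>q\<in>I. \<forall>t\<in>I. q \<le> t \<longrightarrow>
           (\<exists>D. has_bochner_integral_gen (restrict_space lborel {q..t}) (\<lambda>\<sigma>. A \<sigma> (Y \<sigma> \<omega>)) D \<and>
                to_dual i (X t \<omega>) = to_dual i (X q \<omega>) + D
                  + to_dual i (ito_integral P F W (\<lambda>\<sigma> _. B \<sigma>) q t \<omega>))))"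

definition L2_initial ::
  "'o measure \<Rightarrow> (real \<Rightarrow> 'o measure) \<Rightarrow> real \<Rightarrow> ('o \<Rightarrow> 'h::{real_inner, banach, second_countable_topology}) \<Rightarrow> bool" where
  "L2_initial P F s \<zeta> \<longleftrightarrow>
     \<zeta> \<in> borel_measurable (F s) \<and> (\<integral>\<^sup>+ \<omega>. ennreal ((norm (\<zeta> \<omega>))\<^sup>2) \<partial>P) < \<infinity>"

text \<open>\<open>Z\<close> is the solution \<open>X(\<cdot>, s, \<zeta>)\<close>, which is unique up to indistinguishability.\<close>

definition solution_from ::
  "'o measure \<Rightarrow> (real \<Rightarrow> 'o measure) \<Rightarrow>
   (real \<Rightarrow> 'u::{real_inner, banach, second_countable_topology} \<Rightarrow> 'o \<Rightarrow> real) \<Rightarrow>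
   ('v::banach \<Rightarrow> 'h::{real_inner, banach, second_countable_topology}) \<Rightarrow>
   (real \<Rightarrow> 'v \<Rightarrow> ('v \<Rightarrow>\<^sub>L real)) \<Rightarrow> (real \<Rightarrow> ('u \<Rightarrow>\<^sub>L 'h)) \<Rightarrow>
   real \<Rightarrow> real \<Rightarrow> ('o \<Rightarrow> 'h) \<Rightarrow> (real \<Rightarrow> 'o \<Rightarrow> 'h) \<Rightarrow> bool" where
  "solution_from P F W i A B \<alpha> s \<zeta> Z \<longleftrightarrow>
     solution P F W i A B \<alpha> {s..} Z \<and> (AE \<omega> in P. Z s \<omega> = \<zeta> \<omega>)"

definition L2_bounded :: "'o measure \<Rightarrow> (real \<Rightarrow> 'o \<Rightarrow> 'h::real_normed_vector) \<Rightarrow> bool" where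
  "L2_bounded P X \<longleftrightarrow> (SUP t. \<integral>\<^sup>+ \<omega>. ennreal ((norm (X t \<omega>))\<^sup>2) \<partial>P) < \<infinity>"

text \<open>The mean-square distance is taken as a nonnegative extended real, so that finiteness is part
  of every bound on it.\<close>

definition ms_dist :: "'o measure \<Rightarrow> ('o \<Rightarrow> 'h::real_normed_vector) \<Rightarrow> ('o \<Rightarrow> 'h) \<Rightarrow> ennreal" where
  "ms_dist P \<xi> \<eta> = (\<integral>\<^sup>+ \<omega>. ennreal ((norm (\<xi> \<omega> - \<eta> \<omega>))\<^sup>2) \<partial>P)"

definition globally_asymptotically_stable_ms ::
  "'o measure \<Rightarrow> (real \<Rightarrow> 'o measure) \<Rightarrow>
   (real \<Rightarrow> 'u::{real_inner, banach, second_countable_topology} \<Rightarrow> 'o \<Rightarrow> real) \<Rightarrow>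
   ('v::banach \<Rightarrow> 'h::{real_inner, banach, second_countable_topology}) \<Rightarrow>
   (real \<Rightarrow> 'v \<Rightarrow> ('v \<Rightarrow>\<^sub>L real)) \<Rightarrow> (real \<Rightarrow> ('u \<Rightarrow>\<^sub>L 'h)) \<Rightarrow>
   real \<Rightarrow> (real \<Rightarrow> 'o \<Rightarrow> 'h) \<Rightarrow> bool" where
  "globally_asymptotically_stable_ms P F W i A B \<alpha> X \<longleftrightarrow>
     (\<forall>\<zeta> Z. L2_initial P F 0 \<zeta> \<and> solution_from P F W i A B \<alpha> 0 \<zeta> Z \<longrightarrow>
        ((\<lambda>t. ms_dist P (Z t) (X t)) \<longlongrightarrow> 0) at_top)"

end

theory Submission
  imports Defs
begin

text \<open>The noise is additive, so the stochastic integral cancels from the difference of two solutions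
  of the same equation, and the estimate holds path by path. Fix a path, let \<open>d\<close> be the
  difference of the solutions \<open>Z\<close> and \<open>X\<close>, let \<open>Y\<^sub>1\<close>, \<open>Y\<^sub>2\<close> be their \<open>V\<close>-valued versions,
  \<open>y = Y\<^sub>1 - Y\<^sub>2\<close> and \<open>g(\<sigma>) = A(\<sigma>, Y\<^sub>1) - A(\<sigma>, Y\<^sub>2)\<close>. Then \<open>d\<close> solves the deterministic equation
  \<open>d' = g\<close> in \<open>V\<^sup>*\<close>, and strong monotonicity should give
  \<open>(\<parallel>d\<parallel>\<^sup>2)' = 2 \<langle>g, y\<rangle> \<le> - \<lambda> \<parallel>d\<parallel>\<^sup>r\<close>. For \<open>f = \<parallel>d\<parallel>\<^sup>2\<close> this is \<open>f' \<le> - \<lambda> f\<^bsup>r/2\<^esup>\<close>; hence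
  \<open>f\<^bsup>-(r-2)/2\<^esup>\<close> grows at least at the rate \<open>\<lambda> (r - 2) / 2\<close>, which bounds \<open>f\<close> at time \<open>t\<close> by
  \<open>(\<lambda>/2 (r - 2) (t - s))\<^bsup>-2/(r-2)\<^esup>\<close> whatever its value at time \<open>s\<close>
  (\<open>power_decay_if_dissipative\<close>). Both pathwise bounds survive taking expectations.

  The substance is the energy inequality, since \<open>d\<close> is differentiable in \<open>V\<^sup>*\<close> only and \<open>y\<close> is merely
  of class \<open>L\<^sup>\<alpha>\<close>. Only one direction of the energy equality is required, and it starts from
  \<open>\<parallel>d(\<theta>)\<parallel>\<^sup>2 - \<parallel>d(\<theta>-h)\<parallel>\<^sup>2 \<le> 2 \<langle>d(\<theta>) - d(\<theta>-h), i y(\<theta>)\<rangle> = 2 \<integral> \<langle>g(\<rho>), y(\<theta>)\<rangle> d\<rho>\<close>, with \<open>\<rho>\<close> ranging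
  over \<open>[\<theta>-h, \<theta>]\<close>. Replacing \<open>g(\<rho>)\<close> by \<open>g(\<theta>)\<close> makes monotonicity applicable, at the price of
  the error \<open>\<parallel>y(\<theta>)\<parallel> \<parallel>g(\<rho>) - g(\<theta>)\<parallel>\<close>. Approximating \<open>g\<close> in \<open>L\<^sup>1\<close> by continuous functions
  (\<open>continuous_approx_L1_if_bochner\<close>) and splitting according to the size of \<open>y\<close> bounds this error,
  for \<open>\<rho>\<close> close to \<open>\<theta>\<close>, by \<open>E(\<rho>) + E(\<theta>) + \<eta>\<close> with \<open>E\<close> of small integral
  (\<open>integrable_modulus_if_conjugate_growth\<close>). Such an error is additive over short intervals, so that
  the local inequalities can be summed up (\<open>increment_le_integral_if_backward_increments_le\<close>) to
  give \<open>energy_inequality\<close>.\<close>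

section \<open>Bochner integrals in normed spaces\<close>

text \<open>Differences of Borel measurable functions with values in a nonseparable normed space may fail to be
  measurable. Against a simple function there is no such difficulty, because on each of its level
  sets it is constant.\<close>

lemma borel_measurable_norm_diff_simple_function:
  fixes f :: "'a \<Rightarrow> 'b::real_normed_vector"
  assumes f: "f \<in> borel_measurable M" and s: "simple_function M s"
  shows "(\<lambda>y. norm (f y - s y)) \<in> borel_measurable M"
proof -
  have fin: "finite (s ` space M)" using s by (simp add: simple_function_def)
  have "(\<lambda>y. norm (f y - c)) \<in> borel_measurable M" for c
    using f by (rule measurable_compose) (intro borel_measurable_continuous_onI continuous_intros)
  then have "(\<lambda>y. \<Sum>c\<in>s ` space M. indicator (s -` {c} \<inter> space M) y * norm (f y - c)) \<in> borel_measurable M"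
    using s by (intro borel_measurable_sum borel_measurable_times borel_measurable_indicator)
      (auto simp: simple_function_def)
  also have "?this \<longleftrightarrow> ?thesis"
  proof (rule measurable_cong)
    fix y assume "y \<in> space M"
    then show "(\<Sum>c\<in>s ` space M. indicator (s -` {c} \<inter> space M) y * norm (f y - c)) = norm (f y - s y)"
      using fin by (subst sum.remove[of _ "s y"]) (auto simp: indicator_def intro!: sum.neutral)
  qed
  finally show ?thesis .
qed

text \<open>Applied to the evaluation functionals on \<open>V\<^sup>*\<close>, this turns the equation in \<open>V\<^sup>*\<close> into scalar
  equations.\<close>

lemma has_bochner_integral_gen_bounded_linear:
  fixes f :: "'a \<Rightarrow> 'b::real_normed_vector" and T :: "'b \<Rightarrow> 'c::{real_normed_vector, second_countable_topology}"
  assumes "bounded_linear T" and "has_bochner_integral_gen M f x"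
  shows "has_bochner_integral M (\<lambda>y. T (f y)) (T x)"
proof -
  interpret T: bounded_linear T by fact
  from assms(2) obtain s where f [measurable]: "f \<in> borel_measurable M"
    and s: "\<And>n. Bochner_Integration.simple_bochner_integrable M (s n)"
    and lim: "(\<lambda>n. \<integral>\<^sup>+ y. ennreal (norm (f y - s n y)) \<partial>M) \<longlonglongrightarrow> 0"
    and x: "(\<lambda>n. Bochner_Integration.simple_bochner_integral M (s n)) \<longlonglongrightarrow> x"
    unfolding has_bochner_integral_gen_def by blast
  have T_measurable [measurable]: "T \<in> borel_measurable borel"
    by (intro borel_measurable_continuous_onI T.continuous_on continuous_on_id)
  obtain K where K: "K > 0" "\<And>x. norm (T x) \<le> norm x * K"
    using T.pos_bounded by auto
  show ?thesis
  proof (rule has_bochner_integral.intros[where s="\<lambda>n y. T (s n y)"])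
    show "(\<lambda>y. T (f y)) \<in> borel_measurable M" by measurable
    show "Bochner_Integration.simple_bochner_integrable M (\<lambda>y. T (s n y))" for n
      using s[of n] by (intro simple_bochner_integrable_compose2[of "\<lambda>x y. T x"]) (auto simp: T.zero)
    show "(\<lambda>n. Bochner_Integration.simple_bochner_integral M (\<lambda>y. T (s n y))) \<longlonglongrightarrow> T x"
      using T.tendsto[OF x] by (simp add: simple_bochner_integral_linear[OF T.linear_axioms s])
    show "(\<lambda>n. \<integral>\<^sup>+ y. ennreal (norm (T (f y) - T (s n y))) \<partial>M) \<longlonglongrightarrow> 0"
    proof (rule tendsto_sandwich[where f="\<lambda>_. 0"
        and h="\<lambda>n. ennreal K * (\<integral>\<^sup>+ y. ennreal (norm (f y - s n y)) \<partial>M)"])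
      show "(\<lambda>n. ennreal K * (\<integral>\<^sup>+ y. ennreal (norm (f y - s n y)) \<partial>M)) \<longlonglongrightarrow> 0"
        using ennreal_tendsto_cmult[OF _ lim, of "ennreal K"] by simp
      have meas: "(\<lambda>y. ennreal (norm (f y - s n y))) \<in> borel_measurable M" for n
        using borel_measurable_norm_diff_simple_function[OF f] s[of n]
        by (auto elim: simple_bochner_integrable.cases)
      show "\<forall>\<^sub>F n in sequentially. (\<integral>\<^sup>+ y. ennreal (norm (T (f y) - T (s n y))) \<partial>M)
              \<le> ennreal K * (\<integral>\<^sup>+ y. ennreal (norm (f y - s n y)) \<partial>M)"
        using K meas by (intro always_eventually allI, subst nn_integral_cmult[symmetric])
          (auto intro!: nn_integral_mono ennreal_leI simp: ennreal_mult[symmetric] T.diff[symmetric] mult.commute)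
    qed auto
  qed
qed

text \<open>Approximability in \<open>L\<^sup>1\<close> by continuous functions. A measurable majorant \<open>e\<close> of the error takes the
  place of the error itself, whose measurability could be lost for differences of functions with
  values in a nonseparable space.\<close>

definition continuous_approx_L1 :: "real \<Rightarrow> real \<Rightarrow> (real \<Rightarrow> 'e::real_normed_vector) \<Rightarrow> bool" where
  "continuous_approx_L1 a b g \<longleftrightarrow>
     (\<forall>\<epsilon>>0. \<exists>w e. continuous_on {a..b} w \<and> (\<forall>x. 0 \<le> e x) \<and>
        e \<in> borel_measurable (restrict_space lborel {a..b}) \<and>
        (\<integral>\<^sup>+ x. ennreal (e x) \<partial>restrict_space lborel {a..b}) < ennreal \<epsilon> \<and>
        (\<forall>x\<in>{a..b}. norm (g x - w x) \<le> e x))"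

lemma continuous_approx_L1_diff:
  assumes "continuous_approx_L1 a b f" and "continuous_approx_L1 a b g"
  shows "continuous_approx_L1 a b (\<lambda>x. f x - g x)"
  unfolding continuous_approx_L1_def
proof (intro allI impI)
  fix \<epsilon> :: real assume "\<epsilon> > 0"
  then have \<epsilon>: "\<epsilon> / 2 > 0" by simp
  let ?L = "restrict_space lborel {a..b}"
  from assms(1)[unfolded continuous_approx_L1_def, rule_format, OF \<epsilon>] obtain v d where
    v: "continuous_on {a..b} v" "\<forall>x. 0 \<le> d x" "d \<in> borel_measurable ?L"
      "(\<integral>\<^sup>+ x. ennreal (d x) \<partial>?L) < ennreal (\<epsilon> / 2)" "\<forall>x\<in>{a..b}. norm (f x - v x) \<le> d x"
    by blast
  from assms(2)[unfolded continuous_approx_L1_def, rule_format, OF \<epsilon>] obtain w e where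
    w: "continuous_on {a..b} w" "\<forall>x. 0 \<le> e x" "e \<in> borel_measurable ?L"
      "(\<integral>\<^sup>+ x. ennreal (e x) \<partial>?L) < ennreal (\<epsilon> / 2)" "\<forall>x\<in>{a..b}. norm (g x - w x) \<le> e x"
    by blast
  have "(\<integral>\<^sup>+ x. ennreal (d x + e x) \<partial>?L) = (\<integral>\<^sup>+ x. ennreal (d x) \<partial>?L) + (\<integral>\<^sup>+ x. ennreal (e x) \<partial>?L)"
    using v w by (subst nn_integral_add[symmetric]) (auto intro!: nn_integral_cong)
  also have "\<dots> < ennreal (\<epsilon> / 2) + ennreal (\<epsilon> / 2)"
    using v w by (intro add_strict_mono) auto
  also have "\<dots> = ennreal \<epsilon>" using \<open>\<epsilon> > 0\<close> by (simp flip: ennreal_plus)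
  finally have *: "(\<integral>\<^sup>+ x. ennreal (d x + e x) \<partial>?L) < ennreal \<epsilon>" .
  show "\<exists>w e. continuous_on {a..b} w \<and> (\<forall>x. 0 \<le> e x) \<and> e \<in> borel_measurable ?L \<and>
        (\<integral>\<^sup>+ x. ennreal (e x) \<partial>?L) < ennreal \<epsilon> \<and>
        (\<forall>x\<in>{a..b}. norm (f x - g x - w x) \<le> e x)"
  proof (intro exI[of _ "\<lambda>x. v x - w x"] exI[of _ "\<lambda>x. d x + e x"] conjI ballI allI)
    fix x assume x: "x \<in> {a..b}"
    have "norm (f x - g x - (v x - w x)) = norm ((f x - v x) - (g x - w x))" by (simp add: algebra_simps)
    also have "\<dots> \<le> norm (f x - v x) + norm (g x - w x)" by (rule norm_triangle_ineq4)
    finally show "norm (f x - g x - (v x - w x)) \<le> d x + e x" using v w x by fastforce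
  qed (use v w * in \<open>auto intro!: continuous_intros\<close>)
qed

text \<open>Regularity of Lebesgue measure encloses \<open>E\<close> between a closed and an open set that differ by little
  measure; a Urysohn function for this pair is the approximation, and \<open>D\<close> is the gap.\<close>

lemma indicator_continuous_approx:
  fixes E :: "real set"
  assumes "E \<in> sets borel" and "\<epsilon> > 0"
  obtains \<phi> :: "real \<Rightarrow> real" and D where "continuous_on UNIV \<phi>" "D \<in> sets borel"
    "emeasure lborel D < ennreal \<epsilon>" "\<And>x. \<bar>indicator E x - \<phi> x\<bar> \<le> indicator D x"
proof -
  obtain G where G: "open G" "E \<subseteq> G" "emeasure lborel (G - E) < ennreal (\<epsilon> / 2)"
    using outer_regular_lborel[OF assms(1), of "\<epsilon> / 2"] assms(2) by auto
  have "- E \<in> sets borel" using assms(1) by auto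
  then obtain H where H: "open H" "- E \<subseteq> H" "emeasure lborel (H - - E) < ennreal (\<epsilon> / 2)"
    using outer_regular_lborel[of "- E" "\<epsilon> / 2"] assms(2) by auto
  have "closed (- H)" "closed (- G)" "- H \<inter> - G = {}" using G(1,2) H(1,2) by auto
  then obtain \<phi> :: "real \<Rightarrow> real" where \<phi>: "continuous_on UNIV \<phi>" "\<And>x. \<phi> x \<in> closed_segment 1 0"
    "\<And>x. x \<in> - H \<Longrightarrow> \<phi> x = 1" "\<And>x. x \<in> - G \<Longrightarrow> \<phi> x = 0"
    using Urysohn[of "- H" "- G" "1::real" 0] by blast
  have 01: "0 \<le> \<phi> x \<and> \<phi> x \<le> 1" for x
    using \<phi>(2)[of x] by (auto simp: closed_segment_eq_real_ivl split: if_splits)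
  show ?thesis
  proof (rule that[of \<phi> "(G - E) \<union> (H - - E)"])
    have "emeasure lborel ((G - E) \<union> (H - - E)) \<le> emeasure lborel (G - E) + emeasure lborel (H - - E)"
      using assms(1) G H by (intro emeasure_subadditive) auto
    also have "\<dots> < ennreal (\<epsilon> / 2) + ennreal (\<epsilon> / 2)" using G H by (intro add_strict_mono) auto
    also have "\<dots> = ennreal \<epsilon>" using assms(2) by (simp flip: ennreal_plus)
    finally show "emeasure lborel ((G - E) \<union> (H - - E)) < ennreal \<epsilon>" .
    show "\<bar>indicator E x - \<phi> x\<bar> \<le> indicator ((G - E) \<union> (H - - E)) x" for x
      using 01[of x] \<phi>(3)[of x] \<phi>(4)[of x] G(2) H(2) by (auto simp: indicator_def abs_if)
    show "(G - E) \<union> (H - - E) \<in> sets borel" using assms(1) G H by auto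
  qed (rule \<phi>(1))
qed

text \<open>Integrability in the sense of Bochner provides an approximation by simple functions, and the
  indicator functions of their finitely many level sets are replaced by continuous functions.\<close>

lemma continuous_approx_L1_if_bochner:
  assumes "has_bochner_integral_gen (restrict_space lborel {a..b}) g x"
  shows "continuous_approx_L1 a b g"
  unfolding continuous_approx_L1_def
proof (intro allI impI)
  fix \<epsilon> :: real assume \<epsilon>: "\<epsilon> > 0"
  define L where "L = restrict_space lborel {a..b::real}"
  have spL: "space L = {a..b}" by (simp add: L_def space_restrict_space)
  from assms obtain s where f [measurable]: "g \<in> borel_measurable L"
    and s: "\<And>n. Bochner_Integration.simple_bochner_integrable L (s n)"
    and lim: "(\<lambda>n. \<integral>\<^sup>+ y. ennreal (norm (g y - s n y)) \<partial>L) \<longlonglongrightarrow> 0"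
    unfolding has_bochner_integral_gen_def L_def by blast
  have "\<forall>\<^sub>F n in sequentially. (\<integral>\<^sup>+ y. ennreal (norm (g y - s n y)) \<partial>L) < ennreal (\<epsilon> / 2)"
    using order_tendstoD(2)[OF lim, of "ennreal (\<epsilon> / 2)"] \<epsilon> by auto
  then obtain n where n: "(\<integral>\<^sup>+ y. ennreal (norm (g y - s n y)) \<partial>L) < ennreal (\<epsilon> / 2)"
    by (auto simp: eventually_sequentially)
  define S where "S = s n ` {a..b}"
  define E where "E c = s n -` {c} \<inter> {a..b}" for c
  have fin: "finite S" and sE: "\<And>c. c \<in> S \<Longrightarrow> E c \<in> sets L"
    using s[of n] spL by (auto simp: S_def E_def simple_function_def elim: simple_bochner_integrable.cases)
  have E: "E c \<in> sets borel" if "c \<in> S" for c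
    using sE[OF that] by (auto simp: L_def sets_restrict_space)
  \<comment> \<open>The level set of each value \<open>c\<close> contributes an error \<open>norm c * \<kappa> c\<close>; all of them
    together must stay below \<open>\<epsilon> / 2\<close>.\<close>
  define \<kappa> where "\<kappa> c = \<epsilon> / (2 * (real (card S) + 1) * (norm c + 1))" for c :: 'a
  have \<kappa>0: "\<kappa> c > 0" for c using \<epsilon> by (auto simp: \<kappa>_def intro!: divide_pos_pos mult_pos_pos add_nonneg_pos)
  have "\<forall>c\<in>S. \<exists>\<phi> D. continuous_on UNIV (\<phi> :: real \<Rightarrow> real) \<and> D \<in> sets borel \<and>
    emeasure lborel D < ennreal (\<kappa> c) \<and> (\<forall>x. \<bar>indicator (E c) x - \<phi> x\<bar> \<le> indicator D x)"
    using indicator_continuous_approx[OF E \<kappa>0] by metis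
  then obtain \<phi> :: "'a \<Rightarrow> real \<Rightarrow> real" and D where \<phi>: "\<And>c. c \<in> S \<Longrightarrow> continuous_on UNIV (\<phi> c)"
    and D: "\<And>c. c \<in> S \<Longrightarrow> D c \<in> sets borel" "\<And>c. c \<in> S \<Longrightarrow> emeasure lborel (D c) < ennreal (\<kappa> c)"
    and \<phi>D: "\<And>c x. c \<in> S \<Longrightarrow> \<bar>indicator (E c) x - \<phi> c x\<bar> \<le> indicator (D c) x"
    by metis
  define w where "w x = (\<Sum>c\<in>S. \<phi> c x *\<^sub>R c)" for x
  define e1 where "e1 x = norm (g x - s n x)" for x
  define e2 where "e2 x = (\<Sum>c\<in>S. norm c * indicator (D c) x)" for x
  have sx: "s n x = (\<Sum>c\<in>S. indicator (E c) x *\<^sub>R c)" if "x \<in> {a..b}" for x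
    using that fin
    by (subst sum.remove[of _ "s n x"]) (auto simp: indicator_def S_def E_def intro!: sum.neutral)
  have meas1: "e1 \<in> borel_measurable L"
    unfolding e1_def using borel_measurable_norm_diff_simple_function[OF f] s[of n]
    by (auto elim: simple_bochner_integrable.cases)
  have DL: "D c \<inter> {a..b} \<in> sets L" if "c \<in> S" for c
    using D(1)[OF that] by (auto simp: L_def sets_restrict_space)
  have DLm: "indicator (D c) \<in> borel_measurable L" if "c \<in> S" for c
    using D(1)[OF that] unfolding L_def by (intro measurable_restrict_space1) auto
  have meas2: "e2 \<in> borel_measurable L"
    unfolding e2_def using DLm by (intro borel_measurable_sum borel_measurable_times) (auto simp: of_real_def)
  have int2: "(\<integral>\<^sup>+ x. ennreal (e2 x) \<partial>L) \<le> ennreal (\<epsilon> / 2)"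
  proof -
    have "(\<integral>\<^sup>+ x. ennreal (e2 x) \<partial>L) = (\<integral>\<^sup>+ x. (\<Sum>c\<in>S. ennreal (norm c) * indicator (D c) x) \<partial>L)"
      unfolding e2_def by (intro nn_integral_cong) (auto simp: sum_ennreal[symmetric] ennreal_mult ennreal_indicator simp del: sum_ennreal)
    also have "\<dots> = (\<Sum>c\<in>S. \<integral>\<^sup>+ x. ennreal (norm c) * indicator (D c) x \<partial>L)"
      using D(1) unfolding L_def
      by (intro nn_integral_sum borel_measurable_times measurable_restrict_space1 borel_measurable_indicator) auto
    also have "\<dots> \<le> (\<Sum>c\<in>S. ennreal (\<epsilon> / (2 * (real (card S) + 1))))"
    proof (rule sum_mono)
      fix c assume c: "c \<in> S"
      have "(\<integral>\<^sup>+ x. ennreal (norm c) * indicator (D c) x \<partial>L)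
          = (\<integral>\<^sup>+ x. ennreal (norm c) * indicator (D c \<inter> {a..b}) x \<partial>L)"
        using spL by (intro nn_integral_cong) (auto simp: indicator_def)
      also have "\<dots> = ennreal (norm c) * emeasure L (D c \<inter> {a..b})"
        using DL[OF c] by (rule nn_integral_cmult_indicator)
      also have "emeasure L (D c \<inter> {a..b}) = emeasure lborel (D c \<inter> {a..b})"
        using D(1)[OF c] unfolding L_def by (intro emeasure_restrict_space) auto
      also have "\<dots> \<le> emeasure lborel (D c)" using D(1)[OF c] by (intro emeasure_mono) auto
      also have "\<dots> \<le> ennreal (\<kappa> c)" using D(2)[OF c] by simp
      finally have "(\<integral>\<^sup>+ x. ennreal (norm c) * indicator (D c) x \<partial>L) \<le> ennreal (norm c) * ennreal (\<kappa> c)"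
        by (simp add: mult_left_mono)
      also have "\<dots> = ennreal (norm c * \<kappa> c)" using less_imp_le[OF \<kappa>0] by (simp add: ennreal_mult)
      also have "norm c * \<kappa> c \<le> (norm c + 1) * \<kappa> c"
        using less_imp_le[OF \<kappa>0[of c]] by (intro mult_right_mono) auto
      also have "\<dots> = \<epsilon> / (2 * (real (card S) + 1))"
      proof -
        have "norm c + 1 \<noteq> 0" using norm_ge_zero[of c] by linarith
        then show ?thesis by (simp add: \<kappa>_def)
      qed
      finally show "(\<integral>\<^sup>+ x. ennreal (norm c) * indicator (D c) x \<partial>L) \<le> ennreal (\<epsilon> / (2 * (real (card S) + 1)))"
        using ennreal_leI by simp
    qed
    also have "\<dots> = ennreal (real (card S) * (\<epsilon> / (2 * (real (card S) + 1))))"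
      using \<epsilon> by (auto simp: ennreal_of_nat_eq_real_of_nat ennreal_mult[symmetric])
    also have "real (card S) * (\<epsilon> / (2 * (real (card S) + 1))) \<le> \<epsilon> / 2"
      using \<epsilon> by (simp add: field_simps)
    finally show ?thesis using ennreal_leI by simp
  qed
  have e0: "0 \<le> e1 x" "0 \<le> e2 x" for x by (auto simp: e1_def e2_def intro!: sum_nonneg)
  have int: "(\<integral>\<^sup>+ x. ennreal (e1 x + e2 x) \<partial>L) < ennreal \<epsilon>"
  proof -
    have "(\<integral>\<^sup>+ x. ennreal (e1 x + e2 x) \<partial>L) = (\<integral>\<^sup>+ x. ennreal (e1 x) \<partial>L) + (\<integral>\<^sup>+ x. ennreal (e2 x) \<partial>L)"
      using e0 meas1 meas2 by (subst nn_integral_add[symmetric]) (auto intro!: nn_integral_cong)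
    also have "\<dots> < ennreal (\<epsilon> / 2) + ennreal (\<epsilon> / 2)"
    proof -
      have "(\<integral>\<^sup>+ x. ennreal (e1 x) \<partial>L) < ennreal (\<epsilon> / 2)" using n by (simp add: e1_def)
      then have "(\<integral>\<^sup>+ x. ennreal (e1 x) \<partial>L) + (\<integral>\<^sup>+ x. ennreal (e2 x) \<partial>L)
          < ennreal (\<epsilon> / 2) + (\<integral>\<^sup>+ x. ennreal (e2 x) \<partial>L)"
        using int2 by (auto simp: add.commute[of _ "\<integral>\<^sup>+ x. ennreal (e2 x) \<partial>L"] ennreal_add_left_cancel_less top_unique)
      also have "\<dots> \<le> ennreal (\<epsilon> / 2) + ennreal (\<epsilon> / 2)" using int2 by (rule add_left_mono)
      finally show ?thesis .
    qed
    also have "\<dots> = ennreal \<epsilon>" using \<epsilon> by (simp flip: ennreal_plus)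
    finally show ?thesis .
  qed
  show "\<exists>w e. continuous_on {a..b} w \<and> (\<forall>x. 0 \<le> e x) \<and> e \<in> borel_measurable (restrict_space lborel {a..b}) \<and>
        (\<integral>\<^sup>+ x. ennreal (e x) \<partial>restrict_space lborel {a..b}) < ennreal \<epsilon> \<and>
        (\<forall>x\<in>{a..b}. norm (g x - w x) \<le> e x)"
  proof (intro exI[of _ w] exI[of _ "\<lambda>x. e1 x + e2 x"] conjI ballI allI)
    show "continuous_on {a..b} w"
      unfolding w_def by (intro continuous_intros continuous_on_subset[OF \<phi>]) auto
    show "(\<lambda>x. e1 x + e2 x) \<in> borel_measurable (restrict_space lborel {a..b})"
      using meas1 meas2 by (simp add: L_def)
    show "(\<integral>\<^sup>+ x. ennreal (e1 x + e2 x) \<partial>restrict_space lborel {a..b}) < ennreal \<epsilon>"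
      using int by (simp add: L_def)
    fix x assume x: "x \<in> {a..b}"
    have "norm (s n x - w x) = norm (\<Sum>c\<in>S. (indicator (E c) x - \<phi> c x) *\<^sub>R c)"
      by (simp add: sx[OF x] w_def sum_subtractf scaleR_diff_left)
    also have "\<dots> \<le> e2 x"
      unfolding e2_def using \<phi>D by (intro sum_norm_le) (auto simp: mult.commute[of "norm _"] intro!: mult_right_mono)
    finally show "norm (g x - w x) \<le> e1 x + e2 x"
      using norm_triangle_ineq[of "g x - s n x" "s n x - w x"] by (simp add: e1_def)
  qed (use e0 in auto)
qed


section \<open>Growth and decay of real functions\<close>

lemma has_bochner_integral_Icc_imp_has_integral:
  fixes f :: "real \<Rightarrow> real"
  assumes "has_bochner_integral (restrict_space lborel {p..q}) f x"
  shows "(f has_integral x) {p..q}"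
proof -
  have "integrable (restrict_space lborel {p..q}) f" and x: "integral\<^sup>L (restrict_space lborel {p..q}) f = x"
    using assms by (auto simp: has_bochner_integral_iff)
  then have "set_integrable lborel {p..q} f"
    by (simp add: set_integrable_def integrable_restrict_space)
  then have "f integrable_on {p..q}" "(LINT y:{p..q}|lborel. f y) = integral {p..q} f"
    by (rule set_borel_integral_eq_integral)+
  moreover have "(LINT y:{p..q}|lborel. f y) = x"
    using x by (simp add: set_lebesgue_integral_def integral_restrict_space)
  ultimately show ?thesis by (simp add: has_integral_iff)
qed

text \<open>Bounds on backward difference quotients at almost all points do not control a continuous function
  in general, the Cantor function being a counterexample. Here the step size \<open>\<delta>\<close> is the same for all
  points, so the bound may be integrated over \<open>\<theta>\<close> for a fixed \<open>h\<close>: on the left, this leaves the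
  difference of the mean values of \<open>\<psi>\<close> over \<open>[b-h, b]\<close> and \<open>[a, a+h]\<close>, which tends to
  \<open>\<psi> b - \<psi> a\<close> by continuity.\<close>

lemma increment_le_integral_if_backward_increments_le:
  fixes \<psi> k :: "real \<Rightarrow> real"
  assumes "a < b" and cont: "continuous_on {a..b} \<psi>" and k: "k integrable_on {a..b}"
    and N: "negligible N" and "\<delta> > 0"
    and incr: "\<And>\<theta> h. \<lbrakk>\<theta> \<in> {a..b} - N; 0 < h; h < \<delta>; a \<le> \<theta> - h\<rbrakk> \<Longrightarrow> \<psi> \<theta> - \<psi> (\<theta> - h) \<le> h * k \<theta>"
  shows "\<psi> b - \<psi> a \<le> integral {a..b} k"
proof -
  define \<Psi> where "\<Psi> x = integral {a..x} \<psi>" for x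
  define K where "K x = integral {a..x} k" for x
  have deriv: "((\<lambda>y. (\<Psi> y - \<Psi> x) / (y - x)) \<longlongrightarrow> \<psi> x) (at x within {a..b})" if "x \<in> {a..b}" for x
    using integral_has_real_derivative[OF cont that]
    unfolding has_field_derivative_iff \<Psi>_def .
  have contK: "continuous_on {a..b} K"
    unfolding K_def by (rule indefinite_integral_continuous_1[OF k])
  have small: "\<forall>\<^sub>F h in at_right 0. 0 < h \<and> h < \<delta> \<and> h < b - a"
    using \<open>a < b\<close> \<open>\<delta> > 0\<close> eventually_at_right_less[of "0::real"] eventually_at_right[of "0::real" "min \<delta> (b - a)"]
    by (auto simp: eventually_at_right_field intro!: exI[of _ "min \<delta> (b - a)"])
  have toa: "filterlim (\<lambda>h. a + h) (at a within {a..b}) (at_right 0)"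
    unfolding filterlim_at using small
    by (auto elim: eventually_mono intro!: tendsto_eq_intros)
  have tob: "filterlim (\<lambda>h. b - h) (at b within {a..b}) (at_right 0)"
    unfolding filterlim_at using small
    by (auto elim: eventually_mono intro!: tendsto_eq_intros)
  have lim1: "((\<lambda>h. (\<Psi> (a + h) - \<Psi> a) / h) \<longlongrightarrow> \<psi> a) (at_right 0)"
    using filterlim_compose[OF deriv toa] \<open>a < b\<close> by simp
  have "((\<lambda>h. (\<Psi> (b - h) - \<Psi> b) / (- h)) \<longlongrightarrow> \<psi> b) (at_right 0)"
    using filterlim_compose[OF deriv tob] \<open>a < b\<close> by simp
  also have "(\<lambda>h. (\<Psi> (b - h) - \<Psi> b) / (- h)) = (\<lambda>h. (\<Psi> b - \<Psi> (b - h)) / h)"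
    by (auto simp: fun_eq_iff diff_divide_distrib)
  finally have lim2: "((\<lambda>h. (\<Psi> b - \<Psi> (b - h)) / h) \<longlongrightarrow> \<psi> b) (at_right 0)" .
  have lim3: "((\<lambda>h. K (a + h)) \<longlongrightarrow> K a) (at_right 0)"
    using contK \<open>a < b\<close> by (intro filterlim_compose[OF _ toa]) (auto simp: continuous_on_def)
  have step: "(\<Psi> b - \<Psi> (b - h)) / h - (\<Psi> (a + h) - \<Psi> a) / h \<le> K b - K (a + h)"
    if h: "0 < h" "h < \<delta>" "h < b - a" for h
  proof -
    have cont1: "continuous_on {a+h..b} \<psi>" and cont2: "continuous_on {a..b-h} \<psi>"
      using h by (auto intro: continuous_on_subset[OF cont])
    have cont3: "continuous_on {a+h..b} (\<lambda>\<theta>. \<psi> (\<theta> - h))"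
      using h by (intro continuous_on_compose2[OF cont2] continuous_intros) auto
    have k': "k integrable_on {a+h..b}"
      using h by (intro integrable_subinterval_real[OF k]) auto
    \<comment> \<open>Modified on the negligible set so that the bound holds at every point.\<close>
    define k2 where "k2 \<theta> = (if \<theta> \<in> N then (\<psi> \<theta> - \<psi> (\<theta> - h)) / h else k \<theta>)" for \<theta>
    have k2: "k2 integrable_on {a+h..b}" "integral {a+h..b} k = integral {a+h..b} k2"
      using integrable_spike[OF k' N, of k2] integral_spike[OF N, of "{a+h..b}" k2 k] by (auto simp: k2_def)
    have "integral {a+h..b} (\<lambda>\<theta>. \<psi> \<theta> - \<psi> (\<theta> - h)) \<le> integral {a+h..b} (\<lambda>\<theta>. h * k2 \<theta>)"
    proof (rule integral_le)
      show "(\<lambda>\<theta>. \<psi> \<theta> - \<psi> (\<theta> - h)) integrable_on {a+h..b}"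
        using cont1 cont3 by (intro integrable_continuous_interval continuous_intros)
      show "(\<lambda>\<theta>. h * k2 \<theta>) integrable_on {a+h..b}" using k2(1) by (auto simp: integrable_on_def intro: has_integral_mult_right)
      show "\<psi> \<theta> - \<psi> (\<theta> - h) \<le> h * k2 \<theta>" if "\<theta> \<in> {a+h..b}" for \<theta>
        using incr[of \<theta> h] h that by (auto simp: k2_def)
    qed
    also have "\<dots> = h * integral {a+h..b} k" by (simp add: k2(2))
    also have "integral {a+h..b} k = K b - K (a + h)"
      unfolding K_def using Henstock_Kurzweil_Integration.integral_combine[OF _ _ k, of "a + h"] h by simp
    finally have 1: "integral {a+h..b} (\<lambda>\<theta>. \<psi> \<theta> - \<psi> (\<theta> - h)) \<le> h * (K b - K (a + h))" .
    have "integral {a+h..b} (\<lambda>\<theta>. \<psi> \<theta> - \<psi> (\<theta> - h)) = integral {a+h..b} \<psi> - integral {a+h..b} (\<lambda>\<theta>. \<psi> (\<theta> - h))"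
      using cont1 cont3 by (intro integral_diff integrable_continuous_interval)
    also have "integral {a+h..b} (\<lambda>\<theta>. \<psi> (\<theta> - h)) = \<Psi> (b - h)"
      using integral_shift[of "a + h" "- h" b \<psi>] cont2 by (simp add: \<Psi>_def o_def)
    also have "integral {a+h..b} \<psi> = \<Psi> b - \<Psi> (a + h)"
      unfolding \<Psi>_def using Henstock_Kurzweil_Integration.integral_combine[of a "a + h" b \<psi>] h integrable_continuous_interval[OF cont] by simp
    finally have "\<Psi> b - \<Psi> (a + h) - \<Psi> (b - h) \<le> h * (K b - K (a + h))" using 1 by simp
    moreover have "\<Psi> a = 0" by (simp add: \<Psi>_def)
    ultimately have "(\<Psi> b - \<Psi> (b - h) - (\<Psi> (a + h) - \<Psi> a)) / h \<le> K b - K (a + h)"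
      using h by (subst pos_divide_le_eq) (auto simp: algebra_simps)
    then show ?thesis by (simp add: diff_divide_distrib)
  qed
  have "\<psi> b - \<psi> a \<le> K b - K a"
    by (rule tendsto_le[OF _ tendsto_diff[OF tendsto_const lim3] tendsto_diff[OF lim2 lim1]])
      (use small step in \<open>auto elim: eventually_mono\<close>)
  then show ?thesis by (simp add: K_def)
qed

text \<open>The integrated form of \<open>f' \<le> - lam f\<^bsup>q\<^esup>\<close>, with right endpoint \<open>t\<close> throughout. The function \<open>f\<close> need
  not be differentiable, but \<open>G \<tau> = f t + lam \<integral>\<^sub>\<tau>\<^sup>t f\<^bsup>q\<^esup>\<close> is. It lies below \<open>f\<close>, so that
  \<open>G' = - lam f\<^bsup>q\<^esup> \<le> - lam G\<^bsup>q\<^esup>\<close>, and it agrees with \<open>f\<close> at \<open>t\<close>. Integrating from the left endpoint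
  instead would yield a function above \<open>f\<close> and the wrong inequality.\<close>

lemma power_decay_if_dissipative:
  fixes f :: "real \<Rightarrow> real"
  assumes "s < t" and cont: "continuous_on {s..t} f" and f0: "\<And>\<tau>. \<tau> \<in> {s..t} \<Longrightarrow> 0 \<le> f \<tau>"
    and q: "q > 1" and lam: "lam > 0"
    and diss: "\<And>\<tau>. \<tau> \<in> {s..t} \<Longrightarrow> f t + lam * integral {\<tau>..t} (\<lambda>x. f x powr q) \<le> f \<tau>"
  shows "f t \<le> (lam * (q - 1) * (t - s)) powr (- (1 / (q - 1)))"
proof (cases "f t = 0")
  case False
  then have ft: "f t > 0" using f0[of t] \<open>s < t\<close> by auto
  have contq: "continuous_on {s..t} (\<lambda>x. f x powr q)"
    using f0 q by (intro continuous_on_powr' cont continuous_on_const) auto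
  define G where "G \<tau> = f t + lam * integral {\<tau>..t} (\<lambda>x. f x powr q)" for \<tau>
  have Gpos: "f t \<le> G \<tau>" if "\<tau> \<in> {s..t}" for \<tau>
  proof -
    have "0 \<le> integral {\<tau>..t} (\<lambda>x. f x powr q)"
      using that by (intro integral_nonneg integrable_continuous_interval continuous_on_subset[OF contq]) auto
    then show ?thesis using lam by (simp add: G_def)
  qed
  have derG: "(G has_real_derivative - lam * f \<tau> powr q) (at \<tau> within {s..t})" if "\<tau> \<in> {s..t}" for \<tau>
    unfolding G_def using integral_has_real_derivative'[OF contq that]
    by (auto intro!: derivative_eq_intros)
  have der: "((\<lambda>x. G x powr (1 - q)) has_real_derivative (q - 1) * lam * (f \<tau> powr q * G \<tau> powr (- q))) (at \<tau> within {s..t})"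
    if "\<tau> \<in> {s..t}" for \<tau>
  proof -
    have "G \<tau> > 0" using Gpos[OF that] ft by simp
    then show ?thesis
      by (auto intro!: derivative_eq_intros derG that simp: algebra_simps)
  qed
  have "\<exists>\<tau>\<in>{s..t}. G t powr (1 - q) - G s powr (1 - q) = ((q - 1) * lam * (f \<tau> powr q * G \<tau> powr (- q))) * (t - s)"
    using \<open>s < t\<close> der
    by (intro mvt_very_simple[of s t _ "\<lambda>\<tau> x. ((q - 1) * lam * (f \<tau> powr q * G \<tau> powr (- q))) * x", simplified])
      (auto simp: has_field_derivative_def)
  then obtain \<tau> where \<tau>: "\<tau> \<in> {s..t}"
    and eq: "G t powr (1 - q) - G s powr (1 - q) = ((q - 1) * lam * (f \<tau> powr q * G \<tau> powr (- q))) * (t - s)"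
    by blast
  have "G \<tau> > 0" using Gpos[OF \<tau>] ft by simp
  have "G \<tau> powr q \<le> f \<tau> powr q"
    using diss[OF \<tau>] \<open>G \<tau> > 0\<close> q by (intro powr_mono2) (auto simp: G_def)
  then have "1 \<le> f \<tau> powr q * G \<tau> powr (- q)"
    using \<open>G \<tau> > 0\<close> by (simp add: powr_minus field_simps)
  then have "lam * (q - 1) * 1 * (t - s) \<le> lam * (q - 1) * (f \<tau> powr q * G \<tau> powr (- q)) * (t - s)"
    using q lam \<open>s < t\<close> by (intro mult_right_mono mult_left_mono) auto
  also have "\<dots> = G t powr (1 - q) - G s powr (1 - q)"
    unfolding eq by (simp add: mult.commute)
  also have "\<dots> \<le> G t powr (1 - q)" by simp
  also have "G t = f t" by (simp add: G_def)
  finally have *: "lam * (q - 1) * (t - s) \<le> f t powr (1 - q)" by simp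
  have "f t = (f t powr (1 - q)) powr (- (1 / (q - 1)))"
  proof -
    have "(1 - q) * (- (1 / (q - 1))) = 1" using q by (simp add: field_simps)
    then show ?thesis unfolding powr_powr using ft by simp
  qed
  also have "\<dots> \<le> (lam * (q - 1) * (t - s)) powr (- (1 / (q - 1)))"
    using * q lam \<open>s < t\<close> by (intro powr_mono2') auto
  finally show ?thesis .
qed auto


section \<open>The energy inequality\<close>

lemma tail_integral_small:
  fixes u N :: "'a \<Rightarrow> real"
  assumes N: "N \<in> borel_measurable M" and u: "u \<in> borel_measurable M"
    and fin: "(\<integral>\<^sup>+ x. ennreal (u x) \<partial>M) < \<infinity>" and \<epsilon>: "\<epsilon> > 0"
  obtains K :: real where "K \<ge> 1" "(\<integral>\<^sup>+ x. ennreal (indicator {K<..} (N x) * u x) \<partial>M) < ennreal \<epsilon>"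
proof -
  note N [measurable] u [measurable]
  have "(\<lambda>n. \<integral>\<^sup>+ x. ennreal (indicator {real n<..} (N x) * u x) \<partial>M) \<longlonglongrightarrow> (\<integral>\<^sup>+ x. 0 \<partial>M)"
  proof (rule nn_integral_dominated_convergence[where w="\<lambda>x. ennreal (u x)"])
    show "AE x in M. (\<lambda>n. ennreal (indicator {real n<..} (N x) * u x)) \<longlonglongrightarrow> 0"
    proof (rule AE_I2)
      fix x
      obtain m where m: "N x \<le> real m" using real_arch_simple by blast
      have "\<forall>\<^sub>F n in sequentially. ennreal (indicator {real n<..} (N x) * u x) = 0"
        using eventually_ge_at_top[of m] by eventually_elim (use m in \<open>auto simp: indicator_def\<close>)
      then show "(\<lambda>n. ennreal (indicator {real n<..} (N x) * u x)) \<longlonglongrightarrow> 0"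
        by (rule tendsto_eventually)
    qed
  qed (use fin in \<open>auto simp: indicator_def\<close>)
  then have "\<forall>\<^sub>F n in sequentially. (\<integral>\<^sup>+ x. ennreal (indicator {real n<..} (N x) * u x) \<partial>M) < ennreal \<epsilon>"
    using \<epsilon> by (intro order_tendstoD(2)) auto
  then obtain n0 where "\<And>n. n \<ge> n0 \<Longrightarrow> (\<integral>\<^sup>+ x. ennreal (indicator {real n<..} (N x) * u x) \<partial>M) < ennreal \<epsilon>"
    by (auto simp: eventually_sequentially)
  then show ?thesis by (intro that[of "real (max n0 1)"]) auto
qed

text \<open>A modulus of continuity for \<open>g\<close>, weighted by \<open>n\<close>, that holds in the mean: the oscillation of \<open>g\<close>
  over short intervals is dominated by the sum of the values of \<open>E\<close> at the two points, up to \<open>\<eta>\<close>, and \<open>E\<close> has small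
  integral. That the weight is evaluated at \<open>\<theta>\<close> only suffices, because \<open>\<theta>\<close> is the point at which
  the test vector \<open>y(\<theta>)\<close> is taken.\<close>

definition integrable_modulus :: "real \<Rightarrow> real \<Rightarrow> (real \<Rightarrow> real) \<Rightarrow> (real \<Rightarrow> 'e::real_normed_vector) \<Rightarrow> bool" where
  "integrable_modulus a b n g \<longleftrightarrow>
     (\<forall>\<eta>>0. \<exists>E. \<exists>\<delta>>0. (\<forall>x. 0 \<le> E x) \<and> E \<in> borel_measurable (restrict_space lborel {a..b}) \<and>
        (\<integral>\<^sup>+ x. ennreal (E x) \<partial>restrict_space lborel {a..b}) < ennreal \<eta> \<and>
        (\<forall>\<rho>\<in>{a..b}. \<forall>\<theta>\<in>{a..b}. \<bar>\<rho> - \<theta>\<bar> < \<delta> \<longrightarrow> n \<theta> * norm (g \<rho> - g \<theta>) \<le> E \<rho> + E \<theta> + \<eta>))"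

text \<open>Here \<open>N\<close> is of class \<open>L\<^sup>\<alpha>\<close> and \<open>g\<close> of class \<open>L\<^sup>\<beta>\<close> for the conjugate exponent \<open>\<beta>\<close>. Where \<open>N \<theta> \<le> K\<close>,
  the weight is harmless and the approximation of \<open>g\<close> in \<open>L\<^sup>1\<close> by a uniformly continuous function
  suffices. Where \<open>N \<theta> > K\<close>, the growth bound on \<open>g\<close> gives at most \<open>2 C m\<^sup>\<alpha>\<close> for the maximum \<open>m\<close> of
  \<open>N \<rho>\<close> and \<open>N \<theta>\<close>, which exceeds \<open>K\<close>; so one of the two points contributes to the tail integral
  of \<open>N\<^sup>\<alpha>\<close>, which is small for large \<open>K\<close>.\<close>

lemma integrable_modulus_if_conjugate_growth:
  fixes g :: "real \<Rightarrow> 'e::real_normed_vector"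
  assumes approx: "continuous_approx_L1 a b g"
    and N: "N \<in> borel_measurable (restrict_space lborel {a..b})" and N1: "\<And>x. 1 \<le> N x"
    and fin: "(\<integral>\<^sup>+ x. ennreal (N x powr \<alpha>) \<partial>restrict_space lborel {a..b}) < \<infinity>"
    and \<alpha>: "\<alpha> > 1" and C: "C \<ge> 0"
    and g: "\<And>x. x \<in> {a..b} \<Longrightarrow> norm (g x) \<le> C * N x powr (\<alpha> - 1)"
  shows "integrable_modulus a b N g"
  unfolding integrable_modulus_def
proof (intro allI impI)
  fix \<eta> :: real assume \<eta>: "\<eta> > 0"
  define L where "L = restrict_space lborel {a..b::real}"
  note N [folded L_def, measurable]
  have "(\<lambda>x. N x powr \<alpha>) \<in> borel_measurable L" by measurable
  then obtain K where K: "K \<ge> 1"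
    and KT: "(\<integral>\<^sup>+ x. ennreal (indicator {K<..} (N x) * N x powr \<alpha>) \<partial>L) < ennreal (\<eta> / (4 * (C + 1)))"
    using tail_integral_small[of N L "\<lambda>x. N x powr \<alpha>" "\<eta> / (4 * (C + 1))"] fin \<eta> C
    by (auto simp: L_def[symmetric])
  define T where "T x = indicator {K<..} (N x) * N x powr \<alpha>" for x
  have T0: "0 \<le> T x" for x by (simp add: T_def)
  have [measurable]: "T \<in> borel_measurable L" unfolding T_def by measurable
  have "\<eta> / (2 * K) > 0" using \<eta> K by simp
  from approx[unfolded continuous_approx_L1_def, rule_format, OF this] obtain w e where
    w: "continuous_on {a..b} w" and e0: "\<And>x. 0 \<le> e x" and e [measurable]: "e \<in> borel_measurable L"
    and inte: "(\<integral>\<^sup>+ x. ennreal (e x) \<partial>L) < ennreal (\<eta> / (2 * K))"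
    and we: "\<And>x. x \<in> {a..b} \<Longrightarrow> norm (g x - w x) \<le> e x"
    unfolding L_def by blast
  have "uniformly_continuous_on {a..b} w"
    by (rule compact_uniformly_continuous[OF w]) simp
  moreover have "\<eta> / K > 0" using \<eta> K by simp
  ultimately obtain \<delta> where \<delta>: "\<delta> > 0"
    and unif: "\<And>x y. \<lbrakk>x \<in> {a..b}; y \<in> {a..b}; dist y x < \<delta>\<rbrakk> \<Longrightarrow> dist (w y) (w x) < \<eta> / K"
    unfolding uniformly_continuous_on_def by metis
  define E where "E x = K * e x + 2 * C * T x" for x
  have E0: "0 \<le> E x" for x using K C e0 T0 by (simp add: E_def)
  have [measurable]: "E \<in> borel_measurable L" unfolding E_def by measurable
  have "(\<integral>\<^sup>+ x. ennreal (E x) \<partial>L) = (\<integral>\<^sup>+ x. ennreal K * ennreal (e x) + ennreal (2 * C) * ennreal (T x) \<partial>L)"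
    using K C e0 T0 by (intro nn_integral_cong) (simp add: E_def ennreal_mult)
  also have "\<dots> = ennreal K * (\<integral>\<^sup>+ x. ennreal (e x) \<partial>L) + ennreal (2 * C) * (\<integral>\<^sup>+ x. ennreal (T x) \<partial>L)"
    by (simp add: nn_integral_add nn_integral_cmult)
  also have "\<dots> < ennreal (\<eta> / 2) + ennreal (\<eta> / 2)"
  proof (rule add_strict_mono)
    have "ennreal K * (\<integral>\<^sup>+ x. ennreal (e x) \<partial>L) < ennreal K * ennreal (\<eta> / (2 * K))"
      using K inte by (intro ennreal_mult_strict_left_mono) auto
    also have "\<dots> = ennreal (\<eta> / 2)" using K \<eta> by (simp add: ennreal_mult[symmetric])
    finally show "ennreal K * (\<integral>\<^sup>+ x. ennreal (e x) \<partial>L) < ennreal (\<eta> / 2)" .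
    have "ennreal (2 * C) * (\<integral>\<^sup>+ x. ennreal (T x) \<partial>L) \<le> ennreal (2 * C) * ennreal (\<eta> / (4 * (C + 1)))"
      using KT by (intro mult_left_mono) (auto simp: T_def)
    also have "\<dots> = ennreal (2 * C * (\<eta> / (4 * (C + 1))))" using C \<eta> by (intro ennreal_mult[symmetric]) auto
    also have "\<dots> < ennreal (\<eta> / 2)" using C \<eta> by (intro ennreal_lessI) (auto simp: field_simps)
    finally show "ennreal (2 * C) * (\<integral>\<^sup>+ x. ennreal (T x) \<partial>L) < ennreal (\<eta> / 2)" .
  qed
  also have "\<dots> = ennreal \<eta>" using \<eta> by (simp flip: ennreal_plus)
  finally have intE: "(\<integral>\<^sup>+ x. ennreal (E x) \<partial>L) < ennreal \<eta>" .
  have bound: "N \<theta> * norm (g \<rho> - g \<theta>) \<le> E \<rho> + E \<theta> + \<eta>"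
    if \<rho>: "\<rho> \<in> {a..b}" and \<theta>: "\<theta> \<in> {a..b}" and d: "\<bar>\<rho> - \<theta>\<bar> < \<delta>" for \<rho> \<theta>
  proof (cases "N \<theta> \<le> K")
    case True
    have "g \<rho> - g \<theta> = (g \<rho> - w \<rho>) + (w \<rho> - w \<theta>) - (g \<theta> - w \<theta>)" by simp
    also have "norm \<dots> \<le> norm (g \<rho> - w \<rho>) + norm (w \<rho> - w \<theta>) + norm (g \<theta> - w \<theta>)"
      by (meson add_right_mono norm_triangle_ineq norm_triangle_ineq4 order_trans)
    also have "\<dots> \<le> e \<rho> + \<eta> / K + e \<theta>"
      using we[OF \<rho>] we[OF \<theta>] unif[OF \<theta> \<rho>] d by (auto simp: dist_norm)
    finally have "N \<theta> * norm (g \<rho> - g \<theta>) \<le> K * (e \<rho> + \<eta> / K + e \<theta>)"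
      using True N1[of \<theta>] K by (intro mult_mono) auto
    also have "\<dots> = K * e \<rho> + K * e \<theta> + \<eta>" using K by (simp add: field_simps)
    also have "\<dots> \<le> E \<rho> + E \<theta> + \<eta>" using C T0 by (simp add: E_def)
    finally show ?thesis .
  next
    case False
    define m where "m = max (N \<rho>) (N \<theta>)"
    have m: "m > K" "m \<ge> 1" "N \<rho> \<le> m" "N \<theta> \<le> m" using False N1[of \<rho>] by (auto simp: m_def)
    have "norm (g \<rho> - g \<theta>) \<le> C * N \<rho> powr (\<alpha> - 1) + C * N \<theta> powr (\<alpha> - 1)"
      using g[OF \<rho>] g[OF \<theta>] norm_triangle_ineq4[of "g \<rho>" "g \<theta>"] by linarith
    also have "\<dots> \<le> C * m powr (\<alpha> - 1) + C * m powr (\<alpha> - 1)"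
      using m \<alpha> C N1[of \<rho>] N1[of \<theta>] by (intro add_mono mult_left_mono powr_mono2) auto
    finally have "N \<theta> * norm (g \<rho> - g \<theta>) \<le> m * (C * m powr (\<alpha> - 1) + C * m powr (\<alpha> - 1))"
      using m N1[of \<theta>] C by (intro mult_mono) auto
    also have "\<dots> = 2 * C * m powr \<alpha>"
      using m by (simp add: powr_diff field_simps)
    also have "m powr \<alpha> \<le> T \<rho> + T \<theta>"
      using m T0[of \<rho>] T0[of \<theta>] by (auto simp: T_def m_def max_def indicator_def)
    finally have "N \<theta> * norm (g \<rho> - g \<theta>) \<le> 2 * C * (T \<rho> + T \<theta>)" using C by (simp add: mult_left_mono)
    also have "\<dots> = 2 * C * T \<rho> + 2 * C * T \<theta>" by (simp add: algebra_simps)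
    also have "\<dots> \<le> E \<rho> + E \<theta> + \<eta>" using K e0[of \<rho>] e0[of \<theta>] \<eta> by (simp add: E_def add_increasing)
    finally show ?thesis .
  qed
  show "\<exists>E. \<exists>\<delta>>0. (\<forall>x. 0 \<le> E x) \<and> E \<in> borel_measurable (restrict_space lborel {a..b}) \<and>
        (\<integral>\<^sup>+ x. ennreal (E x) \<partial>restrict_space lborel {a..b}) < ennreal \<eta> \<and>
        (\<forall>\<rho>\<in>{a..b}. \<forall>\<theta>\<in>{a..b}. \<bar>\<rho> - \<theta>\<bar> < \<delta> \<longrightarrow> N \<theta> * norm (g \<rho> - g \<theta>) \<le> E \<rho> + E \<theta> + \<eta>)"
    using \<delta> E0 \<open>E \<in> borel_measurable L\<close> intE bound unfolding L_def by blast
qed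

text \<open>The function \<open>\<psi>\<close> in the proof is the energy minus twice a primitive of the error majorant \<open>E\<close>.
  Subtracting this primitive absorbs the part \<open>\<integral> E(\<rho>) d\<rho>\<close> of the error, which is not of
  the form \<open>h\<close> times a function of \<open>\<theta>\<close>. The modulus is assumed on a possibly longer interval, so that
  a single one serves all left endpoints \<open>a\<close>.\<close>

lemma energy_inequality:
  fixes d :: "real \<Rightarrow> 'h::real_inner" and g :: "real \<Rightarrow> ('v::real_normed_vector \<Rightarrow>\<^sub>L real)"
    and i :: "'v \<Rightarrow> 'h"
  assumes "s \<le> a" and "a \<le> b" and cont: "continuous_on {a..b} d"
    and weak: "\<And>p q v. \<lbrakk>a \<le> p; p \<le> q; q \<le> b\<rbrakk> \<Longrightarrow>
        ((\<lambda>\<rho>. blinfun_apply (g \<rho>) v) has_integral (d q - d p) \<bullet> i v) {p..q}"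
    and version: "negligible N" "\<And>\<theta>. \<theta> \<in> {a..b} - N \<Longrightarrow> i (y \<theta>) = d \<theta>"
    and mono: "\<And>\<theta>. 2 * blinfun_apply (g \<theta>) (y \<theta>) \<le> - lam * norm (i (y \<theta>)) powr r"
    and modulus: "integrable_modulus s b n g" and n: "\<And>\<theta>. norm (y \<theta>) \<le> n \<theta>" and "r > 0"
  shows "(norm (d b))\<^sup>2 + lam * integral {a..b} (\<lambda>\<theta>. norm (d \<theta>) powr r) \<le> (norm (d a))\<^sup>2"
proof (cases "a < b")
  case True
  have contr: "continuous_on {a..b} (\<lambda>\<theta>. norm (d \<theta>) powr r)"
    using \<open>r > 0\<close> by (intro continuous_on_powr' continuous_intros cont) auto
  then have intr: "(\<lambda>\<theta>. norm (d \<theta>) powr r) integrable_on {a..b}"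
    by (rule integrable_continuous_interval)
  have main: "(norm (d b))\<^sup>2 - (norm (d a))\<^sup>2 \<le> - lam * integral {a..b} (\<lambda>\<theta>. norm (d \<theta>) powr r) + \<eta> * (4 + 2 * (b - a))"
    if \<eta>: "\<eta> > 0" for \<eta>
  proof -
    from modulus[unfolded integrable_modulus_def, rule_format, OF \<eta>] obtain E \<delta> where
      \<delta>: "\<delta> > 0" and E0: "\<And>x. 0 \<le> E x" and E: "E \<in> borel_measurable (restrict_space lborel {s..b})"
      and intE: "(\<integral>\<^sup>+ x. ennreal (E x) \<partial>restrict_space lborel {s..b}) < ennreal \<eta>"
      and mod: "\<And>\<rho> \<theta>. \<lbrakk>\<rho> \<in> {s..b}; \<theta> \<in> {s..b}; \<bar>\<rho> - \<theta>\<bar> < \<delta>\<rbrakk> \<Longrightarrow> n \<theta> * norm (g \<rho> - g \<theta>) \<le> E \<rho> + E \<theta> + \<eta>"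
      by blast
    have "integrable (restrict_space lborel {s..b}) E"
      using E E0 intE by (intro integrableI_nonneg) (auto simp: less_top[symmetric] dest: order_less_imp_not_eq)
    then have hE: "(E has_integral (integral\<^sup>L (restrict_space lborel {s..b}) E)) {s..b}"
      by (intro has_bochner_integral_Icc_imp_has_integral has_bochner_integral_integrable)
    then have Es: "E integrable_on {s..b}" by blast
    have Eint: "E integrable_on {a..b}"
      by (rule integrable_subinterval_real[OF Es]) (use \<open>s \<le> a\<close> in auto)
    have "ennreal (integral\<^sup>L (restrict_space lborel {s..b}) E) < ennreal \<eta>"
      using intE \<open>integrable (restrict_space lborel {s..b}) E\<close> E0 by (subst nn_integral_eq_integral[symmetric]) auto
    moreover have "0 \<le> integral\<^sup>L (restrict_space lborel {s..b}) E" using E0 by simp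
    ultimately have "integral {s..b} E \<le> \<eta>"
      using hE by (simp add: ennreal_less_iff integral_unique)
    moreover have "integral {a..b} E \<le> integral {s..b} E"
      using \<open>s \<le> a\<close> Eint Es E0 by (intro integral_subset_le) auto
    ultimately have E\<eta>: "integral {a..b} E \<le> \<eta>" by simp
    define J where "J x = integral {a..x} E" for x
    define \<psi> where "\<psi> x = (norm (d x))\<^sup>2 - 2 * J x" for x
    define k where "k \<theta> = - lam * norm (d \<theta>) powr r + 2 * E \<theta> + 2 * \<eta>" for \<theta>
    have kint: "(k has_integral (- lam * integral {a..b} (\<lambda>\<theta>. norm (d \<theta>) powr r) + 2 * integral {a..b} E + 2 * \<eta> * (b - a))) {a..b}"
      unfolding k_def using intr Eint \<open>a \<le> b\<close>
      by (intro has_integral_add has_integral_mult_right integrable_integral)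
        (auto intro!: has_integral_const_real[THEN has_integral_eq_rhs] simp: algebra_simps)
    have "\<psi> b - \<psi> a \<le> integral {a..b} k"
    proof (rule increment_le_integral_if_backward_increments_le[OF True _ _ version(1) \<delta>])
      show "continuous_on {a..b} \<psi>"
        unfolding \<psi>_def J_def by (intro continuous_intros cont indefinite_integral_continuous_1 Eint)
      show "k integrable_on {a..b}" using kint by blast
      fix \<theta> h assume \<theta>: "\<theta> \<in> {a..b} - N" and h: "0 < h" "h < \<delta>" "a \<le> \<theta> - h"
      define p where "p = \<theta> - h"
      have p: "a \<le> p" "p \<le> \<theta>" "\<theta> \<le> b" using h \<theta> by (auto simp: p_def)
      have "(norm (d \<theta>))\<^sup>2 - (norm (d p))\<^sup>2 = 2 * ((d \<theta> - d p) \<bullet> d \<theta>) - (norm (d \<theta> - d p))\<^sup>2"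
        by (simp add: power2_norm_eq_inner algebra_simps inner_commute)
      \<comment> \<open>The square that is dropped has the right sign because the increment is tested at its right
        endpoint \<open>\<theta>\<close>.\<close>
      also have "\<dots> \<le> 2 * ((d \<theta> - d p) \<bullet> i (y \<theta>))" using version(2)[OF \<theta>] by simp
      also have "(d \<theta> - d p) \<bullet> i (y \<theta>) \<le> h * blinfun_apply (g \<theta>) (y \<theta>) + (J \<theta> - J p) + h * E \<theta> + h * \<eta>"
      proof (rule has_integral_le)
        show "((\<lambda>\<rho>. blinfun_apply (g \<rho>) (y \<theta>)) has_integral (d \<theta> - d p) \<bullet> i (y \<theta>)) {p..\<theta>}"
          by (rule weak[OF p])
        have "E integrable_on {p..\<theta>}"
          using p by (intro integrable_subinterval_real[OF Eint]) auto
        moreover have "integral {p..\<theta>} E = J \<theta> - J p"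
          unfolding J_def using Henstock_Kurzweil_Integration.integral_combine[of a p \<theta> E] p integrable_subinterval_real[OF Eint, of a \<theta>] by simp
        ultimately have "(E has_integral (J \<theta> - J p)) {p..\<theta>}"
          by (simp add: has_integral_iff)
        moreover have "((\<lambda>\<rho>. blinfun_apply (g \<theta>) (y \<theta>) + E \<theta> + \<eta>) has_integral (h * (blinfun_apply (g \<theta>) (y \<theta>) + E \<theta> + \<eta>))) {p..\<theta>}"
          using has_integral_const_real[of "blinfun_apply (g \<theta>) (y \<theta>) + E \<theta> + \<eta>" p \<theta>] h(1) by (simp add: p_def)
        ultimately have "((\<lambda>\<rho>. E \<rho> + (blinfun_apply (g \<theta>) (y \<theta>) + E \<theta> + \<eta>)) has_integral
            (J \<theta> - J p) + h * (blinfun_apply (g \<theta>) (y \<theta>) + E \<theta> + \<eta>)) {p..\<theta>}"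
          by (rule has_integral_add)
        then show "((\<lambda>\<rho>. E \<rho> + (blinfun_apply (g \<theta>) (y \<theta>) + E \<theta> + \<eta>)) has_integral
            (h * blinfun_apply (g \<theta>) (y \<theta>) + (J \<theta> - J p) + h * E \<theta> + h * \<eta>)) {p..\<theta>}"
          by (simp add: algebra_simps)
        fix \<rho> assume \<rho>: "\<rho> \<in> {p..\<theta>}"
        have "blinfun_apply (g \<rho>) (y \<theta>) = blinfun_apply (g \<theta>) (y \<theta>) + blinfun_apply (g \<rho> - g \<theta>) (y \<theta>)"
          by (simp add: blinfun.diff_left)
        also have "blinfun_apply (g \<rho> - g \<theta>) (y \<theta>) \<le> norm (g \<rho> - g \<theta>) * norm (y \<theta>)"
          using norm_blinfun[of "g \<rho> - g \<theta>" "y \<theta>"] by simp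
        also have "\<dots> \<le> n \<theta> * norm (g \<rho> - g \<theta>)"
          using n[of \<theta>] by (simp add: mult.commute mult_right_mono)
        also have "\<dots> \<le> E \<rho> + E \<theta> + \<eta>" using \<rho> p h \<open>s \<le> a\<close> by (intro mod) (auto simp: p_def)
        finally show "blinfun_apply (g \<rho>) (y \<theta>) \<le> E \<rho> + (blinfun_apply (g \<theta>) (y \<theta>) + E \<theta> + \<eta>)" by simp
      qed
      also have "2 * (h * blinfun_apply (g \<theta>) (y \<theta>) + (J \<theta> - J p) + h * E \<theta> + h * \<eta>)
          = h * (2 * blinfun_apply (g \<theta>) (y \<theta>)) + 2 * (J \<theta> - J p) + h * (2 * E \<theta> + 2 * \<eta>)"
        by (simp add: algebra_simps)
      also have "h * (2 * blinfun_apply (g \<theta>) (y \<theta>)) \<le> h * (- lam * norm (d \<theta>) powr r)"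
        using mono[of \<theta>] version(2)[OF \<theta>] h(1) by (intro mult_left_mono) auto
      finally show "\<psi> \<theta> - \<psi> (\<theta> - h) \<le> h * k \<theta>"
        by (simp add: \<psi>_def k_def p_def algebra_simps)
    qed
    also have "\<dots> = - lam * integral {a..b} (\<lambda>\<theta>. norm (d \<theta>) powr r) + 2 * integral {a..b} E + 2 * \<eta> * (b - a)"
      using kint by (rule integral_unique)
    finally have "(norm (d b))\<^sup>2 - (norm (d a))\<^sup>2
        \<le> - lam * integral {a..b} (\<lambda>\<theta>. norm (d \<theta>) powr r) + 4 * integral {a..b} E + 2 * \<eta> * (b - a)"
      by (simp add: \<psi>_def J_def)
    then show ?thesis using E\<eta> by (simp add: algebra_simps)
  qed
  have "((\<lambda>\<eta>. - lam * integral {a..b} (\<lambda>\<theta>. norm (d \<theta>) powr r) + \<eta> * (4 + 2 * (b - a))) \<longlongrightarrow>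
      - lam * integral {a..b} (\<lambda>\<theta>. norm (d \<theta>) powr r) + 0 * (4 + 2 * (b - a))) (at_right 0)"
    by (intro tendsto_intros)
  then have "(norm (d b))\<^sup>2 - (norm (d a))\<^sup>2 \<le> - lam * integral {a..b} (\<lambda>\<theta>. norm (d \<theta>) powr r) + 0 * (4 + 2 * (b - a))"
    using main by (intro tendsto_lowerbound) (auto simp: eventually_at_right_less elim!: eventually_mono[OF eventually_at_right_less[of 0]])
  then show ?thesis by simp
next
  case False
  then show ?thesis using \<open>a \<le> b\<close> by simp
qed


section \<open>Contraction of solutions\<close>

lemma blinfun_apply_to_dual:
  assumes "bounded_linear i"
  shows "blinfun_apply (to_dual i x) v = x \<bullet> i v"
proof -
  have "bounded_linear (\<lambda>v. x \<bullet> i v)"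
    using bounded_linear_compose[OF bounded_linear_inner_right assms] .
  then show ?thesis by (simp add: to_dual_def bounded_linear_Blinfun_apply)
qed

text \<open>The deterministic core of the theorem, for a single path. The weight is \<open>1 + \<parallel>Y\<^sub>1\<parallel> + \<parallel>Y\<^sub>2\<parallel>\<close> rather than
  \<open>\<parallel>Y\<^sub>1 - Y\<^sub>2\<parallel>\<close>: it dominates the latter, its measurability follows from that of \<open>Y\<^sub>1\<close> and
  \<open>Y\<^sub>2\<close> separately, and being at least 1 it absorbs the constant \<open>M0\<close> of the boundedness condition.\<close>

lemma pathwise_contraction:
  fixes d :: "real \<Rightarrow> 'h::{real_inner, banach, second_countable_topology}"
    and A :: "real \<Rightarrow> 'v::banach \<Rightarrow> ('v \<Rightarrow>\<^sub>L real)" and Y1 Y2 :: "real \<Rightarrow> 'v"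
  assumes "s < t" and i: "bounded_linear i" and cont: "continuous_on {s..t} d"
    and drift: "\<And>p q. \<lbrakk>s \<le> p; p \<le> q; q \<le> t\<rbrakk> \<Longrightarrow> \<exists>D1 D2.
        has_bochner_integral_gen (restrict_space lborel {p..q}) (\<lambda>\<sigma>. A \<sigma> (Y1 \<sigma>)) D1 \<and>
        has_bochner_integral_gen (restrict_space lborel {p..q}) (\<lambda>\<sigma>. A \<sigma> (Y2 \<sigma>)) D2 \<and>
        to_dual i (d q) = to_dual i (d p) + (D1 - D2)"
    and version: "AE \<sigma> in restrict_space lborel {s..t}. i (Y1 \<sigma> - Y2 \<sigma>) = d \<sigma>"
    and Y1: "Y1 \<in> borel_measurable (restrict_space lborel {s..t})"
      "(\<integral>\<^sup>+ \<sigma>. ennreal (norm (Y1 \<sigma>) powr \<alpha>) \<partial>restrict_space lborel {s..t}) < \<infinity>"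
    and Y2: "Y2 \<in> borel_measurable (restrict_space lborel {s..t})"
      "(\<integral>\<^sup>+ \<sigma>. ennreal (norm (Y2 \<sigma>) powr \<alpha>) \<partial>restrict_space lborel {s..t}) < \<infinity>"
    and r: "r > 2" and lam: "lam > 0" and mono: "strong_monotonicity i A r lam"
    and \<alpha>: "\<alpha> > 1" and c3: "c3 > 0" and M0: "M0 > 0" and bdd: "boundedness A \<alpha> c3 M0"
  shows "(norm (d t))\<^sup>2 \<le> (norm (d s))\<^sup>2"
    and "(norm (d t))\<^sup>2 \<le> (lam / 2 * (r - 2) * (t - s)) powr (- (2 / (r - 2)))"
proof -
  interpret i: bounded_linear i by fact
  define g where "g \<sigma> = A \<sigma> (Y1 \<sigma>) - A \<sigma> (Y2 \<sigma>)" for \<sigma>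
  define y where "y \<sigma> = Y1 \<sigma> - Y2 \<sigma>" for \<sigma>
  define N where "N \<sigma> = 1 + norm (Y1 \<sigma>) + norm (Y2 \<sigma>)" for \<sigma>
  define L where "L = restrict_space lborel {s..t}"
  note [measurable] = Y1(1)[folded L_def] Y2(1)[folded L_def]
  have N1: "1 \<le> N \<sigma>" for \<sigma> by (simp add: N_def)
  have modulus: "integrable_modulus s t N g"
  proof (rule integrable_modulus_if_conjugate_growth)
    show "continuous_approx_L1 s t g"
    proof -
      obtain D1 D2 where
        "has_bochner_integral_gen (restrict_space lborel {s..t}) (\<lambda>\<sigma>. A \<sigma> (Y1 \<sigma>)) D1"
        "has_bochner_integral_gen (restrict_space lborel {s..t}) (\<lambda>\<sigma>. A \<sigma> (Y2 \<sigma>)) D2"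
        using drift[of s t] \<open>s < t\<close> by auto
      then show ?thesis
        unfolding g_def by (intro continuous_approx_L1_diff continuous_approx_L1_if_bochner)
    qed
    have "N \<in> borel_measurable L" unfolding N_def by measurable
    then show "N \<in> borel_measurable (restrict_space lborel {s..t})" by (simp add: L_def)
    show "(\<integral>\<^sup>+ x. ennreal (N x powr \<alpha>) \<partial>restrict_space lborel {s..t}) < \<infinity>"
      unfolding L_def[symmetric]
    proof -
      have bound: "N x powr \<alpha> \<le> 3 powr \<alpha> * (1 + norm (Y1 x) powr \<alpha> + norm (Y2 x) powr \<alpha>)" for x
      proof -
        define m where "m = max 1 (max (norm (Y1 x)) (norm (Y2 x)))"
        have "N x powr \<alpha> \<le> (3 * m) powr \<alpha>"
          using \<alpha> N1[of x] by (intro powr_mono2) (auto simp: N_def m_def)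
        also have "\<dots> = 3 powr \<alpha> * m powr \<alpha>" by (simp add: powr_mult m_def)
        also have "m powr \<alpha> \<le> 1 + norm (Y1 x) powr \<alpha> + norm (Y2 x) powr \<alpha>"
          by (auto simp: m_def max_def)
        finally show ?thesis by simp
      qed
      have "(\<integral>\<^sup>+ x. ennreal (N x powr \<alpha>) \<partial>L)
          \<le> (\<integral>\<^sup>+ x. ennreal (3 powr \<alpha>) * (1 + ennreal (norm (Y1 x) powr \<alpha>) + ennreal (norm (Y2 x) powr \<alpha>)) \<partial>L)"
        using bound by (intro nn_integral_mono)
          (simp add: ennreal_mult[symmetric] ennreal_plus[symmetric] ennreal_leI flip: ennreal_1 del: ennreal_plus)
      also have "\<dots> = ennreal (3 powr \<alpha>) * (emeasure L (space L) + (\<integral>\<^sup>+ x. ennreal (norm (Y1 x) powr \<alpha>) \<partial>L)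
          + (\<integral>\<^sup>+ x. ennreal (norm (Y2 x) powr \<alpha>) \<partial>L))"
        by (simp add: nn_integral_cmult nn_integral_add)
      also have "\<dots> < \<infinity>"
      proof -
        have "emeasure L (space L) < \<infinity>"
          using \<open>s < t\<close> by (simp add: L_def space_restrict_space emeasure_restrict_space)
        then show ?thesis using Y1(2) Y2(2) by (simp add: L_def ennreal_mult_less_top)
      qed
      finally show "(\<integral>\<^sup>+ x. ennreal (N x powr \<alpha>) \<partial>L) < \<infinity>" .
    qed
    show "\<alpha> > 1" by fact
    show "0 \<le> 2 * c3 + 2 * M0" using c3 M0 by simp
    fix x
    have "norm (Y1 x) powr (\<alpha> - 1) \<le> N x powr (\<alpha> - 1)" "norm (Y2 x) powr (\<alpha> - 1) \<le> N x powr (\<alpha> - 1)"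
      using \<alpha> by (auto intro!: powr_mono2 simp: N_def)
    moreover have "1 \<le> N x powr (\<alpha> - 1)" using N1[of x] \<alpha> by (simp add: ge_one_powr_ge_zero)
    moreover have "norm (g x) \<le> (c3 * norm (Y1 x) powr (\<alpha> - 1) + M0) + (c3 * norm (Y2 x) powr (\<alpha> - 1) + M0)"
      unfolding g_def using bdd norm_triangle_ineq4[of "A x (Y1 x)" "A x (Y2 x)"]
      unfolding boundedness_def by (smt (verit))
    ultimately have "norm (g x) \<le> (c3 * N x powr (\<alpha> - 1) + M0 * N x powr (\<alpha> - 1)) + (c3 * N x powr (\<alpha> - 1) + M0 * N x powr (\<alpha> - 1))"
      using c3 M0 by (smt (verit) mult_left_mono mult_cancel_left1)
    then show "norm (g x) \<le> (2 * c3 + 2 * M0) * N x powr (\<alpha> - 1)" by (simp add: algebra_simps)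
  qed (use N1 in auto)
  from version have "AE \<sigma> in lborel. \<sigma> \<in> {s..t} \<longrightarrow> i (y \<sigma>) = d \<sigma>"
    by (simp add: AE_restrict_space_iff y_def)
  then obtain B where B: "B \<in> null_sets lborel" "{\<sigma>. \<not> (\<sigma> \<in> {s..t} \<longrightarrow> i (y \<sigma>) = d \<sigma>)} \<subseteq> B"
    by (auto simp: eventually_ae_filter)
  then have negl: "negligible B"
    by (simp add: negligible_iff_null_sets null_sets_completionI)
  have dissip: "(norm (d t))\<^sup>2 + lam * integral {\<tau>..t} (\<lambda>\<theta>. norm (d \<theta>) powr r) \<le> (norm (d \<tau>))\<^sup>2"
    if \<tau>: "\<tau> \<in> {s..t}" for \<tau>
  proof (rule energy_inequality[OF _ _ _ _ negl _ _ modulus])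
    show "continuous_on {\<tau>..t} d" using \<tau> by (auto intro: continuous_on_subset[OF cont])
    show "i (y \<theta>) = d \<theta>" if "\<theta> \<in> {\<tau>..t} - B" for \<theta>
    proof -
      have "\<theta> \<in> {s..t}" "\<theta> \<notin> B" using that \<tau> by auto
      then show ?thesis using B(2) by blast
    qed
    show "2 * blinfun_apply (g \<theta>) (y \<theta>) \<le> - lam * norm (i (y \<theta>)) powr r" for \<theta>
      using mono by (simp add: strong_monotonicity_def g_def y_def)
    show "norm (y \<theta>) \<le> N \<theta>" for \<theta>
      using norm_triangle_ineq4[of "Y1 \<theta>" "Y2 \<theta>"] by (simp add: y_def N_def)
    fix p q v assume pq: "\<tau> \<le> p" "p \<le> q" "q \<le> t"
    then obtain D1 D2 where
      "has_bochner_integral_gen (restrict_space lborel {p..q}) (\<lambda>\<sigma>. A \<sigma> (Y1 \<sigma>)) D1"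
      "has_bochner_integral_gen (restrict_space lborel {p..q}) (\<lambda>\<sigma>. A \<sigma> (Y2 \<sigma>)) D2"
      and eq: "to_dual i (d q) = to_dual i (d p) + (D1 - D2)"
      using drift[of p q] \<tau> by auto
    then have "has_bochner_integral (restrict_space lborel {p..q})
        (\<lambda>\<sigma>. blinfun_apply (A \<sigma> (Y1 \<sigma>)) v - blinfun_apply (A \<sigma> (Y2 \<sigma>)) v) (blinfun_apply D1 v - blinfun_apply D2 v)"
      by (intro has_bochner_integral_diff
          has_bochner_integral_gen_bounded_linear[where T="\<lambda>f. blinfun_apply f v"] blinfun.bounded_linear_left)
    moreover have "blinfun_apply D1 v - blinfun_apply D2 v = (d q - d p) \<bullet> i v"
      using arg_cong[OF eq, of "\<lambda>f. blinfun_apply f v"]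
      by (simp add: blinfun_apply_to_dual[OF i] blinfun.add_left blinfun.diff_left inner_diff_left)
    ultimately show "((\<lambda>\<rho>. blinfun_apply (g \<rho>) v) has_integral (d q - d p) \<bullet> i v) {p..q}"
      using has_bochner_integral_Icc_imp_has_integral by (simp add: g_def blinfun.diff_left)
  qed (use \<tau> r in auto)
  have int_nonneg: "0 \<le> integral {s..t} (\<lambda>\<theta>. norm (d \<theta>) powr r)"
    using r by (intro integral_nonneg integrable_continuous_interval continuous_on_powr' continuous_intros cont) auto
  then have "0 \<le> lam * integral {s..t} (\<lambda>\<theta>. norm (d \<theta>) powr r)" using lam by simp
  moreover have "s \<in> {s..t}" using \<open>s < t\<close> by simp
  ultimately show "(norm (d t))\<^sup>2 \<le> (norm (d s))\<^sup>2" using dissip[of s] by linarith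
  have powr_half: "((norm (d x))\<^sup>2) powr (r / 2) = norm (d x) powr r" for x
  proof (cases "d x = 0")
    case False
    then show ?thesis using powr_powr[of "norm (d x)" 2 "r / 2"] by simp
  qed (use r in auto)
  have "(norm (d t))\<^sup>2 \<le> (lam * (r / 2 - 1) * (t - s)) powr (- (1 / (r / 2 - 1)))"
    using r lam dissip
    by (intro power_decay_if_dissipative \<open>s < t\<close>) (auto simp: powr_half intro!: continuous_intros cont)
  also have "lam * (r / 2 - 1) * (t - s) = lam / 2 * (r - 2) * (t - s)" by (simp add: field_simps)
  also have "1 / (r / 2 - 1) = 2 / (r - 2)" using r by (simp add: field_simps)
  finally show "(norm (d t))\<^sup>2 \<le> (lam / 2 * (r - 2) * (t - s)) powr (- (2 / (r - 2)))" .
qed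

lemma (in pair_sigma_finite) AE_pair_snd:
  assumes "AE z in M1 \<Otimes>\<^sub>M M2. Q z"
  shows "AE y in M2. AE x in M1. Q (x, y)"
proof -
  interpret swap: pair_sigma_finite M2 M1 ..
  have "AE z in M2 \<Otimes>\<^sub>M M1. Q ((\<lambda>(x, y). (y, x)) z)"
    using assms by (intro AE_distrD[OF measurable_pair_swap']) (simp only: distr_pair_swap[symmetric])
  from swap.AE_pair[OF this] show ?thesis by simp
qed

text \<open>By Fubini's theorem almost every path inherits the properties of the version on the product space.
  Progressive measurability at the right endpoint \<open>b\<close> gives the joint measurability that Tonelli's
  theorem requires on \<open>[a, b]\<close>.\<close>

lemma AE_V_version_path:
  fixes i :: "'v::banach \<Rightarrow> 'h::{real_inner, banach, second_countable_topology}"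
  assumes filt: "complete_filtered_prob_space P F" and V: "V_version P F i \<alpha> I X Y"
    and I: "I \<in> sets borel" and sub: "{a..b} \<subseteq> I" and "a \<le> b"
  shows "AE \<omega> in P. (\<lambda>\<sigma>. Y \<sigma> \<omega>) \<in> borel_measurable (restrict_space lborel {a..b}) \<and>
      (\<integral>\<^sup>+ \<sigma>. ennreal (norm (Y \<sigma> \<omega>) powr \<alpha>) \<partial>restrict_space lborel {a..b}) < \<infinity> \<and>
      (AE \<sigma> in restrict_space lborel {a..b}. i (Y \<sigma> \<omega>) = X \<sigma> \<omega>)"
proof -
  let ?L = "restrict_space lborel {a..b}"
  interpret P: prob_space P using filt by (simp add: complete_filtered_prob_space_def)
  have sf: "sigma_finite_measure (restrict_space lborel J)" if "J \<in> sets borel" for J :: "real set"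
    using that by (intro sigma_finite_measure_restrict_space sigma_finite_lborel) auto
  interpret LP: pair_sigma_finite ?L P
    using sf[of "{a..b}"] by (auto intro: pair_sigma_finite.intro P.sigma_finite_measure_axioms)
  interpret IP: pair_sigma_finite "restrict_space lborel I" P
    using sf[OF I] by (auto intro: pair_sigma_finite.intro P.sigma_finite_measure_axioms)
  have "b \<in> I" using sub \<open>a \<le> b\<close> by auto
  have space_F: "space (F b) = space P" and sets_F: "sets (F b) \<subseteq> sets P"
    using filt by (auto simp: complete_filtered_prob_space_def filtration.space_F)
  have Y: "(\<lambda>(\<sigma>, \<omega>). Y \<sigma> \<omega>) \<in> borel_measurable (?L \<Otimes>\<^sub>M P)"
  proof -
    have "(\<lambda>(\<sigma>, \<omega>). Y \<sigma> \<omega>) \<in> borel_measurable (restrict_space borel (I \<inter> {..b}) \<Otimes>\<^sub>M F b)"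
      using V \<open>b \<in> I\<close> by (simp add: V_version_def progressively_measurable_def)
    moreover have "(\<lambda>z. (fst z, snd z)) \<in> measurable (?L \<Otimes>\<^sub>M P) (restrict_space borel (I \<inter> {..b}) \<Otimes>\<^sub>M F b)"
    proof (rule measurable_Pair)
      have "(\<lambda>\<sigma>. \<sigma>) \<in> measurable ?L (restrict_space borel (I \<inter> {..b}))"
        using sub by (intro measurable_restrict_space2 measurable_restrict_space1)
          (auto simp: space_restrict_space)
      then show "fst \<in> measurable (?L \<Otimes>\<^sub>M P) (restrict_space borel (I \<inter> {..b}))"
        by (rule measurable_compose[OF measurable_fst])
      have "(\<lambda>\<omega>. \<omega>) \<in> measurable P (F b)"
        using sets_F sets.sets_into_space[of _ "F b"] space_F
        by (intro measurableI) (auto simp: Int_absorb2)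
      then show "snd \<in> measurable (?L \<Otimes>\<^sub>M P) (F b)"
        by (rule measurable_compose[OF measurable_snd])
    qed
    ultimately show ?thesis
      using measurable_compose by fastforce
  qed
  have "(\<lambda>\<sigma>. Y \<sigma> \<omega>) \<in> borel_measurable ?L" if "\<omega> \<in> space P" for \<omega>
    using measurable_compose[OF measurable_Pair2'[OF that] Y] by simp
  moreover have "AE \<omega> in P. (\<integral>\<^sup>+ \<sigma>. ennreal (norm (Y \<sigma> \<omega>) powr \<alpha>) \<partial>?L) < \<infinity>"
  proof -
    define u where "u = (\<lambda>(\<sigma>, \<omega>). ennreal (norm (Y \<sigma> \<omega>) powr \<alpha>))"
    have u: "u \<in> borel_measurable (?L \<Otimes>\<^sub>M P)"
    proof -
      have "(\<lambda>v::'v. norm v) \<in> borel_measurable borel"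
        by (intro borel_measurable_continuous_onI continuous_intros)
      then have "(\<lambda>z. norm ((\<lambda>(\<sigma>, \<omega>). Y \<sigma> \<omega>) z)) \<in> borel_measurable (?L \<Otimes>\<^sub>M P)"
        by (rule measurable_compose[OF Y])
      then have "(\<lambda>z. ennreal (norm ((\<lambda>(\<sigma>, \<omega>). Y \<sigma> \<omega>) z) powr \<alpha>)) \<in> borel_measurable (?L \<Otimes>\<^sub>M P)"
        by measurable
      then show ?thesis by (simp add: u_def case_prod_unfold)
    qed
    have "(\<integral>\<^sup>+ \<omega>. (\<integral>\<^sup>+ \<sigma>. u (\<sigma>, \<omega>) \<partial>?L) \<partial>P) < \<infinity>"
      using V sub unfolding LP.nn_integral_snd[OF u] by (auto simp: V_version_def u_def)
    then have "AE \<omega> in P. (\<integral>\<^sup>+ \<sigma>. u (\<sigma>, \<omega>) \<partial>?L) \<noteq> \<infinity>"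
      using LP.M1.borel_measurable_nn_integral[OF measurable_pair_swap[OF u]]
      by (intro nn_integral_noteq_infinite) auto
    then show ?thesis by eventually_elim (simp add: u_def less_top)
  qed
  moreover have "AE \<omega> in P. AE \<sigma> in ?L. i (Y \<sigma> \<omega>) = X \<sigma> \<omega>"
  proof -
    have "AE (\<sigma>, \<omega>) in restrict_space lborel I \<Otimes>\<^sub>M P. i (Y \<sigma> \<omega>) = X \<sigma> \<omega>"
      using V by (simp add: V_version_def)
    from IP.AE_pair_snd[OF this] have "AE \<omega> in P. AE \<sigma> in restrict_space lborel I. i (Y \<sigma> \<omega>) = X \<sigma> \<omega>"
      by simp
    then show ?thesis
    proof eventually_elim
      case (elim \<omega>)
      then have "AE \<sigma> in lborel. \<sigma> \<in> I \<longrightarrow> i (Y \<sigma> \<omega>) = X \<sigma> \<omega>"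
        using I by (simp add: AE_restrict_space_iff)
      then have "AE \<sigma> in lborel. \<sigma> \<in> {a..b} \<longrightarrow> i (Y \<sigma> \<omega>) = X \<sigma> \<omega>"
        by eventually_elim (use sub in auto)
      then show ?case by (simp add: AE_restrict_space_iff)
    qed
  qed
  ultimately show ?thesis by (auto elim: AE_mp)
qed

text \<open>Both equations contain the same process \<open>ito_integral P F W (\<lambda>\<sigma> _. B \<sigma>)\<close>, which cancels from the
  difference and leaves a deterministic equation for every path.\<close>

lemma solutions_contract_almost_surely:
  fixes i :: "'v::banach \<Rightarrow> 'h::{real_inner, banach, second_countable_topology}"
    and W :: "real \<Rightarrow> 'u::{real_inner, banach, second_countable_topology} \<Rightarrow> 'o \<Rightarrow> real"
  assumes i: "bounded_linear i" and filt: "complete_filtered_prob_space P F"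
    and r: "r > 2" and lam: "lam > 0" and mono: "strong_monotonicity i A r lam"
    and \<alpha>: "\<alpha> > 1" and c3: "c3 > 0" and M0: "M0 > 0" and bdd: "boundedness A \<alpha> c3 M0"
    and Z: "solution P F W i A B \<alpha> I Z" and X: "solution P F W i A B \<alpha> I' X"
    and I: "I \<in> sets borel" "{s..t} \<subseteq> I" and I': "I' \<in> sets borel" "{s..t} \<subseteq> I'" and "s < t"
  shows "AE \<omega> in P. (norm (Z t \<omega> - X t \<omega>))\<^sup>2 \<le> (norm (Z s \<omega> - X s \<omega>))\<^sup>2 \<and>
      (norm (Z t \<omega> - X t \<omega>))\<^sup>2 \<le> (lam / 2 * (r - 2) * (t - s)) powr (- (2 / (r - 2)))"
proof -
  interpret i: bounded_linear i by fact
  from Z obtain Y1 where contZ: "AE \<omega> in P. continuous_on I (\<lambda>t. Z t \<omega>)"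
    and V1: "V_version P F i \<alpha> I Z Y1"
    and eqZ: "AE \<omega> in P. \<forall>q\<in>I. \<forall>t\<in>I. q \<le> t \<longrightarrow>
           (\<exists>D. has_bochner_integral_gen (restrict_space lborel {q..t}) (\<lambda>\<sigma>. A \<sigma> (Y1 \<sigma> \<omega>)) D \<and>
                to_dual i (Z t \<omega>) = to_dual i (Z q \<omega>) + D
                  + to_dual i (ito_integral P F W (\<lambda>\<sigma> _. B \<sigma>) q t \<omega>))"
    unfolding solution_def by blast
  from X obtain Y2 where contX: "AE \<omega> in P. continuous_on I' (\<lambda>t. X t \<omega>)"
    and V2: "V_version P F i \<alpha> I' X Y2"
    and eqX: "AE \<omega> in P. \<forall>q\<in>I'. \<forall>t\<in>I'. q \<le> t \<longrightarrow>
           (\<exists>D. has_bochner_integral_gen (restrict_space lborel {q..t}) (\<lambda>\<sigma>. A \<sigma> (Y2 \<sigma> \<omega>)) D \<and>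
                to_dual i (X t \<omega>) = to_dual i (X q \<omega>) + D
                  + to_dual i (ito_integral P F W (\<lambda>\<sigma> _. B \<sigma>) q t \<omega>))"
    unfolding solution_def by blast
  have path1: "AE \<omega> in P. (\<lambda>\<sigma>. Y1 \<sigma> \<omega>) \<in> borel_measurable (restrict_space lborel {s..t}) \<and>
      (\<integral>\<^sup>+ \<sigma>. ennreal (norm (Y1 \<sigma> \<omega>) powr \<alpha>) \<partial>restrict_space lborel {s..t}) < \<infinity> \<and>
      (AE \<sigma> in restrict_space lborel {s..t}. i (Y1 \<sigma> \<omega>) = Z \<sigma> \<omega>)"
    using \<open>s < t\<close> by (intro AE_V_version_path[OF filt V1 I]) simp
  have path2: "AE \<omega> in P. (\<lambda>\<sigma>. Y2 \<sigma> \<omega>) \<in> borel_measurable (restrict_space lborel {s..t}) \<and>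
      (\<integral>\<^sup>+ \<sigma>. ennreal (norm (Y2 \<sigma> \<omega>) powr \<alpha>) \<partial>restrict_space lborel {s..t}) < \<infinity> \<and>
      (AE \<sigma> in restrict_space lborel {s..t}. i (Y2 \<sigma> \<omega>) = X \<sigma> \<omega>)"
    using \<open>s < t\<close> by (intro AE_V_version_path[OF filt V2 I']) simp
  from contZ contX eqZ eqX path1 path2 show ?thesis
  proof eventually_elim
    case (elim \<omega>)
    have cont: "continuous_on {s..t} (\<lambda>\<tau>. Z \<tau> \<omega> - X \<tau> \<omega>)"
      using elim(1,2) I(2) I'(2) by (intro continuous_on_diff) (auto intro: continuous_on_subset)
    have drift: "\<exists>D1 D2.
        has_bochner_integral_gen (restrict_space lborel {p..q}) (\<lambda>\<sigma>. A \<sigma> (Y1 \<sigma> \<omega>)) D1 \<and>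
        has_bochner_integral_gen (restrict_space lborel {p..q}) (\<lambda>\<sigma>. A \<sigma> (Y2 \<sigma> \<omega>)) D2 \<and>
        to_dual i (Z q \<omega> - X q \<omega>) = to_dual i (Z p \<omega> - X p \<omega>) + (D1 - D2)"
      if pq: "s \<le> p" "p \<le> q" "q \<le> t" for p q
    proof -
      have mem: "p \<in> I" "q \<in> I" "p \<in> I'" "q \<in> I'" using pq I(2) I'(2) by auto
      obtain D1 where D1: "has_bochner_integral_gen (restrict_space lborel {p..q}) (\<lambda>\<sigma>. A \<sigma> (Y1 \<sigma> \<omega>)) D1"
        "to_dual i (Z q \<omega>) = to_dual i (Z p \<omega>) + D1 + to_dual i (ito_integral P F W (\<lambda>\<sigma> _. B \<sigma>) p q \<omega>)"
        using elim(3) mem pq(2) by blast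
      obtain D2 where D2: "has_bochner_integral_gen (restrict_space lborel {p..q}) (\<lambda>\<sigma>. A \<sigma> (Y2 \<sigma> \<omega>)) D2"
        "to_dual i (X q \<omega>) = to_dual i (X p \<omega>) + D2 + to_dual i (ito_integral P F W (\<lambda>\<sigma> _. B \<sigma>) p q \<omega>)"
        using elim(4) mem pq(2) by blast
      have "to_dual i (x - y) = to_dual i x - to_dual i y" for x y
        by (rule blinfun_eqI) (simp add: blinfun_apply_to_dual[OF i] blinfun.diff_left inner_diff_left)
      then have "to_dual i (Z q \<omega> - X q \<omega>) = to_dual i (Z p \<omega> - X p \<omega>) + (D1 - D2)"
        using D1(2) D2(2) by simp
      then show ?thesis using D1(1) D2(1) by blast
    qed
    have version: "AE \<sigma> in restrict_space lborel {s..t}. i (Y1 \<sigma> \<omega> - Y2 \<sigma> \<omega>) = Z \<sigma> \<omega> - X \<sigma> \<omega>"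
      using elim(5,6) by (auto simp: i.diff elim: AE_mp)
    note contraction = pathwise_contraction[where d="\<lambda>\<tau>. Z \<tau> \<omega> - X \<tau> \<omega>" and ?Y1.0="\<lambda>\<sigma>. Y1 \<sigma> \<omega>"
        and ?Y2.0="\<lambda>\<sigma>. Y2 \<sigma> \<omega>", OF \<open>s < t\<close> i cont drift version _ _ _ _ r lam mono \<alpha> c3 M0 bdd]
    show ?case using contraction elim(5,6) by blast
  qed
qed

theorem theorem6p3:
  fixes P :: "'o measure" and F :: "real \<Rightarrow> 'o measure"
    and W :: "real \<Rightarrow> 'u::{real_inner, banach, second_countable_topology} \<Rightarrow> 'o \<Rightarrow> real"
    and i :: "'v::banach \<Rightarrow> 'h::{real_inner, banach, second_countable_topology}"
    and A :: "real \<Rightarrow> 'v \<Rightarrow> ('v \<Rightarrow>\<^sub>L real)"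
    and B :: "real \<Rightarrow> ('u \<Rightarrow>\<^sub>L 'h)"
    and X :: "real \<Rightarrow> 'o \<Rightarrow> 'h"
    and r lam \<alpha> c1 c2 c3 M0 :: real
  assumes "gelfand_triple i"
    and "complete_filtered_prob_space P F"
    and "cylindrical_wiener P F W"
    and "(\<lambda>(t, v). A t v) \<in> borel_measurable (borel \<Otimes>\<^sub>M borel)"
    and "B \<in> measurable borel hs_borel"
    and "hemicontinuity A"
    and "r > 2" and "lam > 0" and "strong_monotonicity i A r lam"
    and "\<alpha> > 1" and "c2 > 0" and "M0 > 0" and "coercivity i A B \<alpha> c1 c2 M0"
    and "c3 > 0" and "boundedness A \<alpha> c3 M0"
    and "solution P F W i A B \<alpha> UNIV X" and "L2_bounded P X"
  shows "globally_asymptotically_stable_ms P F W i A B \<alpha> X \<and>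
    (\<forall>s t \<zeta> Z. s \<le> t \<and> L2_initial P F s \<zeta> \<and> solution_from P F W i A B \<alpha> s \<zeta> Z \<longrightarrow>
       ms_dist P (Z t) (X t)
         \<le> min (ms_dist P \<zeta> (X s))
               (if t = s then \<infinity>
                else ennreal ((lam / 2 * (r - 2) * (t - s)) powr (- (2 / (r - 2))))))"
proof
  interpret P: prob_space P using assms(2) by (simp add: complete_filtered_prob_space_def)
  have i: "bounded_linear i" using assms(1) by (simp add: gelfand_triple_def)
  let ?b = "\<lambda>s t. (lam / 2 * (r - 2) * (t - s)) powr (- (2 / (r - 2)))"
  have bounds: "ms_dist P (Z t) (X t) \<le> ms_dist P \<zeta> (X s) \<and> ms_dist P (Z t) (X t) \<le> ennreal (?b s t)"
    if "s < t" and Z: "solution_from P F W i A B \<alpha> s \<zeta> Z" for s t \<zeta> Z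
  proof -
    have sol: "solution P F W i A B \<alpha> {s..} Z" and init: "AE \<omega> in P. Z s \<omega> = \<zeta> \<omega>"
      using Z by (auto simp: solution_from_def)
    have contract: "AE \<omega> in P. (norm (Z t \<omega> - X t \<omega>))\<^sup>2 \<le> (norm (Z s \<omega> - X s \<omega>))\<^sup>2 \<and>
        (norm (Z t \<omega> - X t \<omega>))\<^sup>2 \<le> ?b s t"
      by (rule solutions_contract_almost_surely[OF i assms(2) assms(7-10) assms(14) assms(12) assms(15) sol assms(16)])
        (use \<open>s < t\<close> in auto)
    have "ms_dist P (Z t) (X t) \<le> ms_dist P \<zeta> (X s)"
      unfolding ms_dist_def
    proof (rule nn_integral_mono_AE)
      from contract init
      show "AE \<omega> in P. ennreal ((norm (Z t \<omega> - X t \<omega>))\<^sup>2) \<le> ennreal ((norm (\<zeta> \<omega> - X s \<omega>))\<^sup>2)"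
        by eventually_elim (simp add: ennreal_leI)
    qed
    moreover have "ms_dist P (Z t) (X t) \<le> (\<integral>\<^sup>+ \<omega>. ennreal (?b s t) \<partial>P)"
      unfolding ms_dist_def
    proof (rule nn_integral_mono_AE)
      from contract show "AE \<omega> in P. ennreal ((norm (Z t \<omega> - X t \<omega>))\<^sup>2) \<le> ennreal (?b s t)"
        by eventually_elim (simp add: ennreal_leI)
    qed
    ultimately show ?thesis by (simp add: P.emeasure_space_1)
  qed
  show "\<forall>s t \<zeta> Z. s \<le> t \<and> L2_initial P F s \<zeta> \<and> solution_from P F W i A B \<alpha> s \<zeta> Z \<longrightarrow>
       ms_dist P (Z t) (X t) \<le> min (ms_dist P \<zeta> (X s)) (if t = s then \<infinity> else ennreal (?b s t))"
  proof (intro allI impI)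
    fix s t \<zeta> Z assume *: "s \<le> t \<and> L2_initial P F s \<zeta> \<and> solution_from P F W i A B \<alpha> s \<zeta> Z"
    show "ms_dist P (Z t) (X t) \<le> min (ms_dist P \<zeta> (X s)) (if t = s then \<infinity> else ennreal (?b s t))"
    proof (cases "t = s")
      case True
      have "AE \<omega> in P. Z s \<omega> = \<zeta> \<omega>" using * by (simp add: solution_from_def)
      then have "ms_dist P (Z s) (X s) = ms_dist P \<zeta> (X s)"
        unfolding ms_dist_def by (intro nn_integral_cong_AE) auto
      then show ?thesis using True by simp
    next
      case False
      then show ?thesis using bounds[of s t \<zeta> Z] * by simp
    qed
  qed
  show "globally_asymptotically_stable_ms P F W i A B \<alpha> X"
    unfolding globally_asymptotically_stable_ms_def
  proof (intro allI impI)
    fix \<zeta> Z assume *: "L2_initial P F 0 \<zeta> \<and> solution_from P F W i A B \<alpha> 0 \<zeta> Z"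
    have "((\<lambda>t. ?b 0 t) \<longlongrightarrow> 0) at_top"
    proof (rule tendsto_neg_powr)
      have "lam / 2 * (r - 2) > 0" using assms(7,8) by simp
      from filterlim_tendsto_pos_mult_at_top[OF tendsto_const this filterlim_ident]
      show "filterlim (\<lambda>t. lam / 2 * (r - 2) * (t - 0)) at_top at_top" by simp
    qed (use assms(7) in simp)
    then have lim: "((\<lambda>t. ennreal (?b 0 t)) \<longlongrightarrow> 0) at_top"
      using tendsto_ennrealI by fastforce
    show "((\<lambda>t. ms_dist P (Z t) (X t)) \<longlongrightarrow> 0) at_top"
    proof (rule tendsto_sandwich[OF _ _ tendsto_const lim])
      show "\<forall>\<^sub>F t in at_top. ms_dist P (Z t) (X t) \<le> ennreal (?b 0 t)"
        using eventually_gt_at_top[of 0] by eventually_elim (use bounds * in blast)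
    qed simp
  qed
qed

end
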